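(* Let $\theta\in(1,\infty)$. Let $(\mathscr{S}_0,d_0)$ be a complete metric space endowed with an additional topology $\sigma$ that is Hausdorff, weaker than the topology induced by $d_0$, and such that $d_0(u,v)\le\liminf_{k\to\infty}d_0(u_k,v_k)$ whenever $u_k\overset{\sigma}{\rightharpoonup}u$ and $v_k\overset{\sigma}{\rightharpoonup}v$. Let $\big((\mathscr{S}_\varepsilon,d_\varepsilon)\big)_{\varepsilon>0}$ be metric spaces with $\mathscr{S}_\varepsilon\subset\mathscr{S}_0$ and $d_0(u,v)\le d_\varepsilon(u,v)$ for all $u,v\in\mathscr{S}_\varepsilon$, $\varepsilon>0$. Let $\phi:\mathscr{S}_0\to(-\infty,\infty]$ with $\mathscr{D}(\phi)=\{\phi<\infty\}\neq\emptyset$ satisfy: ($\Phi$1) if $u_k\overset{\sigma}{\rightharpoonup}u$ and $\sup_{k,l}d_0(u_k,u_l)<\infty$, then $\phi(u)\le\liminf_{k\to\infty}\phi(u_k)$; ($\Phi$2) there exist $u_*\in\mathscr{S}_0$, $B\in\mathbb{R}$, $C>0$ such that $\phi(u)\ge B-C\,d_0(u,u_* )^\theta$ for all $u\in\mathscr{S}_0$; ($\Phi$3) every sequence $(u_k)\subset\mathscr{S}_0$ with $\sup_k\phi(u_k)<\infty$ and $\sup_{k,l}d_0(u_k,u_l)<\infty$ has a subsequence that $\sigma$-converges to some $u\in\mathscr{S}_0$. Let $u_0\in\mathscr{D}(\phi)$, and for every $\varepsilon>0$ let $u_{0,\varepsilon}\in\mathscr{S}_\varepsilon$ be such that $\sup_{\varepsilon>0}d_0(u_{0,\varepsilon},u_0)<\infty$,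 $u_{0,\varepsilon}\overset{\sigma}{\rightharpoonup}u_0$ and $\phi(u_{0,\varepsilon})\to\phi(u_0)$ as $\varepsilon\to0$, and let $\boldsymbol{u}_\varepsilon\in AC^\theta_{\mathrm{loc}}([0,\infty),(\mathscr{S}_\varepsilon,d_\varepsilon))$ be a $\theta$-curve of maximal slope for $\phi$ (restricted to $\mathscr{S}_\varepsilon$) with respect to the strong upper gradient $g_\varepsilon$ starting at $u_{0,\varepsilon}$. Assume in addition that $g$ is a strong upper gradient for $\phi$ with respect to $\mathscr{S}_0$ such that $\liminf_{\varepsilon\to0}g_\varepsilon(u_\varepsilon)\ge g(u)$ whenever $u_\varepsilon\in\mathscr{S}_\varepsilon$ and $u_\varepsilon\overset{\sigma}{\rightharpoonup}u\in\mathscr{S}_0$ as $\varepsilon\to0$ (along null sequences of parameters $\varepsilon$). Let $\varepsilon_k\to0$ and $\boldsymbol{u}^*\in AC^\theta_{\mathrm{loc}}([0,\infty),(\mathscr{S}_0,d_0))$ be a limiting curve, i.e. $\boldsymbol{u}^*(0)=u_0$ and $\boldsymbol{u}_{\varepsilon_k}(t)\overset{\sigma}{\rightharpoonup}\boldsymbol{u}^*(t)$ as $k\to\infty$ for every $t\ge0$. Then $\boldsymbol{u}^*$ is a $\theta$-curve of maximal slope for $\phi$ (with respect to $g$, in $(\mathscr{S}_0,d_0)$) starting at $u_0$.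
   Context: For a metric space $(\mathscr{S},d)$ and an interval $I$: $\boldsymbol{u}\in AC^\theta(I,\mathscr{S})$ (resp. $AC^\theta_{\mathrm{loc}}$) if there is $m\in L^\theta(I)$ (resp. $L^\theta_{\mathrm{loc}}(I)$) with $d(\boldsymbol{u}(s),\boldsymbol{u}(t))\le\int_s^tm(r)\,dr$ for all $s<t$ in $I$; $AC=AC^1$. The metric derivative is $|\boldsymbol{u}'|(t)=\lim_{s\to t}\frac{d(\boldsymbol{u}(t),\boldsymbol{u}(s))}{|t-s|}$ (exists a.e.). A map $g:\mathscr{S}\to[0,\infty]$ is a strong upper gradient for $\phi$ (on $\mathscr{D}(\phi)$) if for every $\boldsymbol{v}\in AC(I,\mathscr{D}(\phi))$ the function $g\circ\boldsymbol{v}$ is Borel measurable and $|\phi(\boldsymbol{v}(t))-\phi(\boldsymbol{v}(s))|\le\int_s^tg(\boldsymbol{v}(r))|\boldsymbol{v}'|(r)\,dr$ for all $s<t$ in $I$. A $\theta$-curve of maximal slope for $\phi$ with respect to a strong upper gradient $g$ starting at $w_0\in\mathscr{D}(\phi)$ is $\boldsymbol{u}\in AC^\theta_{\mathrm{loc}}([0,\infty),\mathscr{S})$ with $\boldsymbol{u}(0)=w_0$ and $\phi(\boldsymbol{u}(t))-\phi(\boldsymbol{u}(s))=-\frac1\beta\int_s^tg^\beta(\boldsymbol{u}(r))\,dr-\frac1\theta\int_s^t|\boldsymbol{u}'|^\theta(r)\,dr$ for all $0\le s<t<\infty$, where $\frac1\theta+\frac1\beta=1$. For $\boldsymbol{u}_\varepsilon$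 and $g_\varepsilon$ these notions are taken in $(\mathscr{S}_\varepsilon,d_\varepsilon)$. $\overset{\sigma}{\rightharpoonup}$ denotes convergence in $\sigma$. Under the hypotheses preceding "in addition", such a limiting curve $\boldsymbol{u}^*$ and sequence $\varepsilon_k$ exist. *)

theory Defs
  imports "HOL-Analysis.Analysis"
begin

text \<open>A metric space is a pair of a carrier set and a distance as in the locale
  \<^locale>\<open>Metric_space\<close>, since the statement compares a whole family of metrics on
  subsets of one set. Functionals and gradients are total functions whose values outside
  the carrier are irrelevant.\<close>

definition Lp_on :: "real \<Rightarrow> real set \<Rightarrow> (real \<Rightarrow> real) \<Rightarrow> bool" where
  "Lp_on p I m \<longleftrightarrow>
     set_borel_measurable lborel I m \<and> set_integrable lborel I (\<lambda>r. \<bar>m r\<bar> powr p)"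

definition Lp_loc_on :: "real \<Rightarrow> real set \<Rightarrow> (real \<Rightarrow> real) \<Rightarrow> bool" where
  "Lp_loc_on p I m \<longleftrightarrow>
     set_borel_measurable lborel I m \<and> (\<forall>K. compact K \<and> K \<subseteq> I \<longrightarrow> Lp_on p K m)"

definition AC_bound :: "real set \<Rightarrow> ('a \<Rightarrow> 'a \<Rightarrow> real) \<Rightarrow> (real \<Rightarrow> 'a) \<Rightarrow> (real \<Rightarrow> real) \<Rightarrow> bool" where
  "AC_bound I d u m \<longleftrightarrow>
     (\<forall>s\<in>I. \<forall>t\<in>I. s < t \<longrightarrow> d (u s) (u t) \<le> (LINT r:{s..t}|lborel. m r))"

definition AC_on :: "real \<Rightarrow> real set \<Rightarrow> 'a set \<Rightarrow> ('a \<Rightarrow> 'a \<Rightarrow> real) \<Rightarrow> (real \<Rightarrow> 'a) \<Rightarrow> bool" where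
  "AC_on p I S d u \<longleftrightarrow> (\<forall>t\<in>I. u t \<in> S) \<and> (\<exists>m. Lp_on p I m \<and> AC_bound I d u m)"

definition AC_loc_on :: "real \<Rightarrow> real set \<Rightarrow> 'a set \<Rightarrow> ('a \<Rightarrow> 'a \<Rightarrow> real) \<Rightarrow> (real \<Rightarrow> 'a) \<Rightarrow> bool" where
  "AC_loc_on p I S d u \<longleftrightarrow> (\<forall>t\<in>I. u t \<in> S) \<and> (\<exists>m. Lp_loc_on p I m \<and> AC_bound I d u m)"

text \<open>Where the limit does not exist (a null set, for absolutely continuous curves), the
  value of \<^const>\<open>Lim\<close> is a fixed unspecified real, so neither integrals nor measurability
  are affected.\<close>

definition metric_deriv :: "real set \<Rightarrow> ('a \<Rightarrow> 'a \<Rightarrow> real) \<Rightarrow> (real \<Rightarrow> 'a) \<Rightarrow> real \<Rightarrow> real" where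
  "metric_deriv I d u t = Lim (at t within I) (\<lambda>s. d (u t) (u s) / \<bar>t - s\<bar>)"

definition eff_dom :: "'a set \<Rightarrow> ('a \<Rightarrow> ereal) \<Rightarrow> 'a set" where
  "eff_dom S \<phi> = {u \<in> S. \<phi> u < \<infinity>}"

text \<open>The product in the integrand follows the measure-theoretic convention
  $0 \cdot \infty = 0$ of \<^typ>\<open>ennreal\<close>.\<close>

definition strong_upper_gradient ::
    "'a set \<Rightarrow> ('a \<Rightarrow> 'a \<Rightarrow> real) \<Rightarrow> ('a \<Rightarrow> ereal) \<Rightarrow> ('a \<Rightarrow> ennreal) \<Rightarrow> bool" where
  "strong_upper_gradient S d \<phi> g \<longleftrightarrow>
     (\<forall>I v. is_interval I \<and> AC_on 1 I (eff_dom S \<phi>) d v \<longrightarrow>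
        (\<lambda>r. g (v r)) \<in> borel_measurable (restrict_space borel I) \<and>
        (\<forall>s\<in>I. \<forall>t\<in>I. s < t \<longrightarrow>
           \<bar>\<phi> (v t) - \<phi> (v s)\<bar> \<le>
             enn2ereal (\<integral>\<^sup>+r\<in>{s..t}. g (v r) * ennreal (metric_deriv I d v r) \<partial>lborel)))"

text \<open>Real powers on $[0,\infty]$, for positive exponents.\<close>

definition ennreal_powr :: "ennreal \<Rightarrow> real \<Rightarrow> ennreal" where
  "ennreal_powr x p = (if x = \<infinity> then \<infinity> else ennreal (enn2real x powr p))"

text \<open>The parameter \<open>\<beta>\<close> is meant to be the conjugate exponent of \<open>\<theta>\<close>. Since \<open>\<phi> w0\<close> is
  finite, the equation with \<open>s = 0\<close> forces \<open>\<phi> (u t) < \<infinity>\<close> for all \<open>t \<ge> 0\<close>, so that no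
  difference of infinities is ever taken.\<close>

definition curve_of_maximal_slope ::
    "real \<Rightarrow> real \<Rightarrow> 'a set \<Rightarrow> ('a \<Rightarrow> 'a \<Rightarrow> real) \<Rightarrow> ('a \<Rightarrow> ereal) \<Rightarrow> ('a \<Rightarrow> ennreal) \<Rightarrow> 'a
      \<Rightarrow> (real \<Rightarrow> 'a) \<Rightarrow> bool" where
  "curve_of_maximal_slope \<theta> \<beta> S d \<phi> g w0 u \<longleftrightarrow>
     strong_upper_gradient S d \<phi> g \<and>
     w0 \<in> eff_dom S \<phi> \<and>
     AC_loc_on \<theta> {0..} S d u \<and>
     u 0 = w0 \<and>
     (\<forall>s t. 0 \<le> s \<and> s < t \<longrightarrow>
        \<phi> (u t) - \<phi> (u s) =
          - (ereal (1 / \<beta>) * enn2ereal (\<integral>\<^sup>+r\<in>{s..t}. ennreal_powr (g (u r)) \<beta> \<partial>lborel))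
          - ereal (1 / \<theta>) *
              enn2ereal (\<integral>\<^sup>+r\<in>{s..t}. ennreal (metric_deriv {0..} d u r powr \<theta>) \<partial>lborel))"

end

theory Submission
  imports Defs
begin

text \<open>The energy identity of the approximating curves, combined with the lower bound on \<open>\<phi>\<close>,
  bounds them uniformly on compact time intervals, so that \<open>\<phi>\<close> is lower semicontinuous along
  them. Fatou's lemma handles the slope term. For the velocity term no weak compactness in
  \<open>L\<^sup>\<theta>\<close> is needed: the lower limit \<open>V t\<close> of the integrals of \<open>\<bar>u\<^sub>k'\<bar>\<^sup>\<theta>\<close> over
  \<open>[0, t]\<close> is nondecreasing, its difference quotients dominate those of the limit curve raised to
  the power \<open>\<theta>\<close> (by Jensen's inequality and lower semicontinuity of \<open>d\<^sub>0\<close>), and the integral of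
  the derivative of a monotone function is at most its increment. Passing to the limit in the
  energy identity on \<open>[0, t]\<close> yields one inequality; the strong upper gradient \<open>g\<close> and
  Young's inequality give the converse one on every subinterval.\<close>

section \<open>Lebesgue differentiation\<close>

text \<open>Only the initial energies converge. At a time s > 0 the energies of the approximating
  curves are merely bounded below in the limit, so the identity on [s, t] cannot be passed to the
  limit directly; the inequality on [0, t] and the reverse ones on [0, s] and [s, t] together leave
  no slack. A second obstacle is that the coercivity bound has order \<theta>, the same power of the
  distance that the dissipation controls: the energy may drop as fast as the curve moves away. Only
  the factor (t - s)^(\<theta> - 1) from Jensen's inequality, small for short times, breaks the
  circle. A third is that \<open>metric_deriv\<close> is a \<open>Lim\<close>, which carries
  information only where the limit exists. Its integrals are therefore computed through an
  integrable function on the whole line that agrees with it almost everywhere on a bounded interval;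
  producing that function calls for the differentiation of integrals and for densities of absolutely
  continuous functions. Lower limits are superadditive, which is all that the monotonicity of
  \<open>V\<close> and the control of its increments require.\<close>

lemma set_integrable_interval:
  fixes f :: "real \<Rightarrow> real"
  assumes "integrable lborel f"
  shows "set_integrable lborel {y..z} f"
  unfolding set_integrable_def by (rule integrable_mult_indicator) (use assms in auto)

lemma set_integrable_const_interval: "set_integrable lborel {y..z::real} (\<lambda>_. c::real)"
  unfolding set_integrable_def by (cases "y \<le> z") auto

text \<open>The measure with density \<open>(f - q)\<^sup>+\<close> vanishes on \<open>{f < q}\<close>, hence is small on some
  neighbourhood of it, while every interval with average at least \<open>p\<close> has measure at least
  \<open>p - q\<close> times its length; a Vitali covering by such intervals is therefore short.\<close>

lemma negligible_large_averages:
  fixes f :: "real \<Rightarrow> real" and a p q :: real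
  assumes f: "integrable lborel f" and "q < p"
  shows "negligible {x. \<bar>x\<bar> < a \<and> f x < q \<and>
    (\<forall>\<delta>>0. \<exists>y z. y \<le> x \<and> x \<le> z \<and> y < z \<and> z - y < \<delta> \<and> p * (z - y) \<le> (LINT r:{y..z}|lborel. f r))}"
    (is "negligible ?E")
  unfolding negligible_outer_le
proof (intro allI impI)
  fix e :: real assume "e > 0"
  have [measurable]: "f \<in> borel_measurable borel" using f by auto
  \<comment> \<open>The conversion \<open>ennreal\<close> truncates f - q at 0. The cutoff to (-a,
    a) makes \<nu> finite, as \<open>outer_regular\<close> requires; for q < 0 the truncated
    function is not integrable over the line.\<close>
  define \<nu> where "\<nu> = density lborel (\<lambda>x. ennreal (f x - q) * indicator {-a<..<a} x)"
  have sets_nu[simp]: "sets \<nu> = sets borel" and space_nu[simp]: "space \<nu> = UNIV"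
    unfolding \<nu>_def by auto
  have em: "emeasure \<nu> X = (\<integral>\<^sup>+x. ennreal (f x - q) * indicator ({-a<..<a} \<inter> X) x \<partial>lborel)"
    if "X \<in> sets borel" for X
    unfolding \<nu>_def using that
    by (subst emeasure_density) (auto intro!: nn_integral_cong simp: indicator_inter_arith mult.assoc)
  have int: "set_integrable lborel {y..z} (\<lambda>x. f x - q)" for y z
    by (intro set_integral_diff set_integrable_interval f set_integrable_const_interval)
  have "(\<integral>\<^sup>+x. ennreal (f x - q) * indicator ({-a<..<a} \<inter> UNIV) x \<partial>lborel)
     \<le> (\<integral>\<^sup>+x. ennreal (norm (indicator {-a..a} x *\<^sub>R (f x - q))) \<partial>lborel)"
    by (intro nn_integral_mono) (auto simp: indicator_def intro!: ennreal_leI)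
  also have "\<dots> < \<infinity>"
    using int[of "-a" a] unfolding set_integrable_def integrable_iff_bounded by auto
  finally have fin: "emeasure \<nu> (space \<nu>) \<noteq> \<infinity>"
    by (simp add: em)
  let ?A = "{x. f x < q}"
  have A[measurable]: "?A \<in> sets borel" by measurable
  have "emeasure \<nu> ?A = (\<integral>\<^sup>+x. 0 \<partial>(lborel :: real measure))"
    unfolding em[OF A] by (intro nn_integral_cong) (auto simp: indicator_def ennreal_neg)
  then have "(INF U\<in>{U. ?A \<subseteq> U \<and> open U}. emeasure \<nu> U) = 0"
    using outer_regular[OF sets_nu fin A] by simp
  moreover have "0 < ennreal (e * (p - q))" using \<open>e > 0\<close> \<open>q < p\<close> by simp
  ultimately have "(INF U\<in>{U. ?A \<subseteq> U \<and> open U}. emeasure \<nu> U) < ennreal (e * (p - q))" by simp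
  then obtain U where U: "?A \<subseteq> U" "open U" "emeasure \<nu> U < ennreal (e * (p - q))"
    unfolding INF_less_iff by auto
  \<comment> \<open>The intervals given for x merely contain it, so the balls are indexed by their
    own midpoint and radius rather than by x.\<close>
  define K where "K = {(c, r). 0 < r \<and> cball c r \<subseteq> U \<inter> {-a<..<a} \<and> p * (2 * r) \<le> (LINT x:cball c r|lborel. f x)}"
  obtain C where C: "countable C" "C \<subseteq> K"
     "pairwise (\<lambda>i j. disjnt (cball (fst i) (snd i)) (cball (fst j) (snd j))) C"
     "negligible(?E - (\<Union>i \<in> C. cball (fst i) (snd i)))"
  proof (rule Vitali_covering_theorem_cballs[of K snd ?E fst])
    show "\<And>i. i \<in> K \<Longrightarrow> 0 < snd i" by (auto simp: K_def)
    fix x d :: real assume x: "x \<in> ?E" and "d > 0"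
    have "open (U \<inter> {-a<..<a})" using U by auto
    moreover have "x \<in> U \<inter> {-a<..<a}" using x U by auto
    ultimately obtain k where k: "k > 0" "cball x k \<subseteq> U \<inter> {-a<..<a}"
      using open_contains_cball by meson
    \<comment> \<open>Length below \<open>k\<close> keeps the interval inside the open set; length
      below \<open>d\<close> makes it small enough for a fine cover.\<close>
    obtain y z where yz: "y \<le> x" "x \<le> z" "y < z" "z - y < min k d" "p * (z - y) \<le> (LINT r:{y..z}|lborel. f r)"
      using x k \<open>d > 0\<close> by (auto dest!: spec[of _ "min k d"])
    define c r where "c = (y + z) / 2" and "r = (z - y) / 2"
    have cb: "cball c r = {y..z}" and r: "2 * r = z - y" "0 < r" "r < d"
      using yz by (auto simp: cball_eq_atLeastAtMost field_simps c_def r_def)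
    have "{y..z} \<subseteq> cball x k" using yz by (auto simp: cball_eq_atLeastAtMost)
    then have "(c, r) \<in> K"
      unfolding K_def mem_Collect_eq case_prod_conv cb r(1) using yz r k by auto
    then show "\<exists>i. i \<in> K \<and> x \<in> cball (fst i) (snd i) \<and> snd i < d"
      using yz cb r by (intro exI[of _ "(c, r)"]) auto
  qed
  let ?X = "\<lambda>i. cball (fst i) (snd i)"
  define W where "W = (\<Union>i\<in>C. ?X i)"
  have [measurable]: "W \<in> sets borel" unfolding W_def using C(1) by (intro sets.countable_UN'') auto
  have disj: "disjoint_family_on ?X C"
    using C(3) unfolding disjoint_family_on_def pairwise_def disjnt_def by auto
  have le: "ennreal (p - q) * emeasure lborel (?X i) \<le> emeasure \<nu> (?X i)" if "i \<in> C" for i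
  proof -
    obtain c r where i: "i = (c, r)" by force
    have r: "0 < r" "{c-r..c+r} \<subseteq> {-a<..<a}" "p * (2 * r) \<le> (LINT x:{c-r..c+r}|lborel. f x)"
      using that C(2) unfolding K_def i by (auto simp: cball_eq_atLeastAtMost)
    have "ennreal (p - q) * emeasure lborel (?X i) = ennreal ((p - q) * (2 * r))"
      using r \<open>q < p\<close> by (simp add: i cball_eq_atLeastAtMost ennreal_mult)
    also have "(p - q) * (2 * r) \<le> (LINT x:{c-r..c+r}|lborel. f x - q)"
    proof -
      have "(LINT x:{c-r..c+r}|lborel. f x - q) = (LINT x:{c-r..c+r}|lborel. f x) - (LINT x:{c-r..c+r}|lborel. q)"
        by (intro set_integral_diff set_integrable_interval f set_integrable_const_interval)
      also have "(LINT x:{c-r..c+r}|lborel. q) = q * (2 * r)"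
        using r by (simp add: set_lebesgue_integral_def)
      finally show ?thesis using r by (simp add: algebra_simps)
    qed
    then have "ennreal ((p - q) * (2 * r)) \<le> ennreal (LINT x:{c-r..c+r}|lborel. f x - q)"
      by (rule ennreal_leI)
    also have "\<dots> \<le> ennreal (LINT x|lborel. max 0 (indicator {c-r..c+r} x *\<^sub>R (f x - q)))"
      using int[of "c-r" "c+r"] unfolding set_lebesgue_integral_def set_integrable_def
      by (intro ennreal_leI integral_mono) auto
    also have "\<dots> = (\<integral>\<^sup>+x. ennreal (max 0 (indicator {c-r..c+r} x *\<^sub>R (f x - q))) \<partial>lborel)"
      using int[of "c-r" "c+r"] unfolding set_integrable_def
      by (intro nn_integral_eq_integral[symmetric]) auto
    also have "\<dots> \<le> emeasure \<nu> (?X i)"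
      using r unfolding i by (subst em) (auto intro!: nn_integral_mono simp: cball_eq_atLeastAtMost indicator_def max_def ennreal_neg)
    finally show ?thesis .
  qed
  have "ennreal (p - q) * emeasure lborel W = (\<integral>\<^sup>+i. ennreal (p - q) * emeasure lborel (?X i) \<partial>count_space C)"
    unfolding W_def by (subst emeasure_UN_countable[OF _ C(1) disj]) (auto simp: nn_integral_cmult)
  also have "\<dots> \<le> (\<integral>\<^sup>+i. emeasure \<nu> (?X i) \<partial>count_space C)"
    by (intro nn_integral_mono) (auto intro: le)
  also have "\<dots> = emeasure \<nu> W"
    unfolding W_def by (rule emeasure_UN_countable[OF _ C(1) disj, symmetric]) auto
  also have "\<dots> \<le> emeasure \<nu> U"
  proof (rule emeasure_mono)
    have "?X i \<subseteq> U" if "i \<in> K" for i using that unfolding K_def by (cases i) auto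
    then show "W \<subseteq> U" unfolding W_def using C(2) by blast
  qed (use U in auto)
  also have "\<dots> < ennreal (e * (p - q))" by (rule U)
  also have "\<dots> = ennreal (p - q) * ennreal e" using \<open>e > 0\<close> \<open>q < p\<close> by (simp add: ennreal_mult mult.commute)
  finally have "emeasure lborel W < ennreal e"
    by (meson leD leI mult_left_mono zero_le)
  then have emW: "emeasure lborel W \<le> ennreal e" by simp
  \<comment> \<open>The uncovered remainder is negligible but perhaps not Borel, hence the passage
    from \<open>lborel\<close> to \<open>lebesgue\<close>.\<close>
  define Z where "Z = ?E - W"
  have neg: "Z \<in> null_sets lebesgue" using C(4) unfolding W_def Z_def negligible_iff_null_sets .
  have emT: "emeasure lebesgue (W \<union> Z) = emeasure lborel W"
    using neg by (subst emeasure_Un_null_set) auto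
  show "\<exists>T. ?E \<subseteq> T \<and> T \<in> lmeasurable \<and> measure lebesgue T \<le> e"
  proof (intro exI conjI)
    show "?E \<subseteq> W \<union> Z" unfolding Z_def by auto
    have "W \<union> Z \<in> sets lebesgue"
      using neg by (intro sets.Un) (auto simp: null_sets_def)
    then show "W \<union> Z \<in> lmeasurable"
      using emT emW by (intro fmeasurableI) (auto simp: less_top[symmetric] top_unique)
    show "measure lebesgue (W \<union> Z) \<le> e"
      unfolding measure_def emT using emW \<open>e > 0\<close> by (simp add: enn2real_leI)
  qed
qed

text \<open>If the conclusion fails at x for some c > f x, two rationals q < p fit strictly between
  f x and c, and x lies in one of countably many negligible sets. The intervals only have to contain
  x, so one-sided ones are included.\<close>

lemma AE_averages_less:
  fixes f :: "real \<Rightarrow> real"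
  assumes f: "integrable lborel f"
  shows "AE x in lborel. \<forall>c > f x. \<exists>\<delta>>0. \<forall>y z. y \<le> x \<and> x \<le> z \<and> y < z \<and> z - y < \<delta> \<longrightarrow>
     (LINT r:{y..z}|lborel. f r) < c * (z - y)"
proof -
  define E where "E n q p = {x. \<bar>x\<bar> < real n \<and> f x < of_rat q \<and>
    (\<forall>\<delta>>0. \<exists>y z. y \<le> x \<and> x \<le> z \<and> y < z \<and> z - y < \<delta> \<and> of_rat p * (z - y) \<le> (LINT r:{y..z}|lborel. f r))}" for n q p
  have "AE x in lborel. x \<notin> E n q p" if "q < p" for n q p
  proof -
    have "negligible (E n q p)" unfolding E_def using that
      by (intro negligible_large_averages[OF f]) (simp add: of_rat_less)
    then have "AE x in lebesgue. x \<notin> E n q p"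
      by (simp add: negligible_iff_null_sets AE_not_in)
    then show ?thesis by (simp add: AE_completion_iff)
  qed
  then have "AE x in lborel. \<forall>n q p. q < p \<longrightarrow> x \<notin> E n q p"
    by (subst AE_all_countable, intro allI)+ auto
  then show ?thesis
  proof (eventually_elim, intro allI impI)
    fix x c assume x: "\<forall>n q p. q < p \<longrightarrow> x \<notin> E n q p" and "f x < c"
    obtain q where q: "f x < of_rat q" "of_rat q < c" using of_rat_dense[OF \<open>f x < c\<close>] by auto
    obtain p where p: "of_rat q < (of_rat p :: real)" "of_rat p < c" using of_rat_dense[OF q(2)] by auto
    obtain n :: nat where n: "\<bar>x\<bar> < real n" using reals_Archimedean2 by blast
    have "x \<notin> E n q p" using x p by (simp add: of_rat_less)
    then obtain \<delta> where d: "\<delta> > 0" "\<And>y z. y \<le> x \<Longrightarrow> x \<le> z \<Longrightarrow> y < z \<Longrightarrow> z - y < \<delta> \<Longrightarrow> (LINT r:{y..z}|lborel. f r) < of_rat p * (z - y)"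
      using n q unfolding E_def by (clarsimp simp: not_le) (metis not_le)
    show "\<exists>\<delta>>0. \<forall>y z. y \<le> x \<and> x \<le> z \<and> y < z \<and> z - y < \<delta> \<longrightarrow> (LINT r:{y..z}|lborel. f r) < c * (z - y)"
    proof (intro exI conjI allI impI)
      show "\<delta> > 0" by fact
      fix y z assume yz: "y \<le> x \<and> x \<le> z \<and> y < z \<and> z - y < \<delta>"
      then have "(LINT r:{y..z}|lborel. f r) < of_rat p * (z - y)" using d by auto
      also have "\<dots> < c * (z - y)" using yz p by simp
      finally show "(LINT r:{y..z}|lborel. f r) < c * (z - y)" .
    qed
  qed
qed

text \<open>The bound on averages for f and for -f gives the two halves of the limit; since x may be
  an end point of the interval, left and right difference quotients are both covered.\<close>

lemma lebesgue_differentiation: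
  fixes f F :: "real \<Rightarrow> real"
  assumes f: "integrable lborel f"
    and F: "\<And>y z. y \<le> z \<Longrightarrow> F z - F y = (LINT r:{y..z}|lborel. f r)"
  shows "AE x in lborel. (F has_real_derivative f x) (at x)"
  using AE_averages_less[OF f] AE_averages_less[OF integrable_minus[OF f]]
proof eventually_elim
  fix x
  assume 1: "\<forall>c > f x. \<exists>\<delta>>0. \<forall>y z. y \<le> x \<and> x \<le> z \<and> y < z \<and> z - y < \<delta> \<longrightarrow>
     (LINT r:{y..z}|lborel. f r) < c * (z - y)"
    and 2: "\<forall>c > - f x. \<exists>\<delta>>0. \<forall>y z. y \<le> x \<and> x \<le> z \<and> y < z \<and> z - y < \<delta> \<longrightarrow>
     (LINT r:{y..z}|lborel. - f r) < c * (z - y)"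
  show "(F has_real_derivative f x) (at x)"
    unfolding has_field_derivative_iff
  proof (rule order_tendstoI)
    fix c assume "c < f x"
    then obtain \<delta> where d: "\<delta> > 0" "\<And>y z. y \<le> x \<Longrightarrow> x \<le> z \<Longrightarrow> y < z \<Longrightarrow> z - y < \<delta> \<Longrightarrow>
       (LINT r:{y..z}|lborel. - f r) < - c * (z - y)"
      using 2 by (metis neg_less_iff_less)
    then have d2: "c * (z - y) < F z - F y" if "y \<le> x" "x \<le> z" "y < z" "z - y < \<delta>" for y z
      using that F[of y z] by (fastforce simp: set_lebesgue_integral_def)
    show "\<forall>\<^sub>F y in at x. c < (F y - F x) / (y - x)"
      unfolding eventually_at
    proof (intro exI conjI ballI impI)
      show "\<delta> > 0" by fact
      fix y assume "y \<noteq> x \<and> dist y x < \<delta>"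
      then show "c < (F y - F x) / (y - x)"
        using d2[of x y] d2[of y x] by (cases "x < y") (auto simp: dist_real_def field_simps)
    qed
  next
    fix c assume "f x < c"
    then obtain \<delta> where d: "\<delta> > 0" "\<And>y z. y \<le> x \<Longrightarrow> x \<le> z \<Longrightarrow> y < z \<Longrightarrow> z - y < \<delta> \<Longrightarrow>
       (LINT r:{y..z}|lborel. f r) < c * (z - y)"
      using 1 by metis
    then have d2: "F z - F y < c * (z - y)" if "y \<le> x" "x \<le> z" "y < z" "z - y < \<delta>" for y z
      using that F[of y z] by simp
    show "\<forall>\<^sub>F y in at x. (F y - F x) / (y - x) < c"
      unfolding eventually_at
    proof (intro exI conjI ballI impI)
      show "\<delta> > 0" by fact
      fix y assume "y \<noteq> x \<and> dist y x < \<delta>"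
      then show "(F y - F x) / (y - x) < c"
        using d2[of x y] d2[of y x] by (cases "x < y") (auto simp: dist_real_def field_simps)
    qed
  qed
qed

section \<open>Primitives and densities of absolutely continuous functions\<close>

lemma set_integral_atMost_diff:
  fixes f :: "real \<Rightarrow> real"
  assumes f: "integrable lborel f" and "s \<le> t"
  shows "(LINT r:{..t}|lborel. f r) - (LINT r:{..s}|lborel. f r) = (LINT r:{s..t}|lborel. f r)"
proof -
  have i: "set_integrable lborel A f" if "A \<in> sets borel" for A
    unfolding set_integrable_def by (rule integrable_mult_indicator) (use f that in auto)
  have "(LINT r:{..t}|lborel. f r) - (LINT r:{..s}|lborel. f r) =
     (LINT r|lborel. indicator {..t} r *\<^sub>R f r - indicator {..s} r *\<^sub>R f r)"
    unfolding set_lebesgue_integral_def using i[of "{..t}"] i[of "{..s}"]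
    by (intro Bochner_Integration.integral_diff[symmetric]) (auto simp: set_integrable_def)
  also have "\<dots> = (LINT r:{s..t}|lborel. f r)"
    unfolding set_lebesgue_integral_def using f
    by (intro integral_cong_AE borel_measurable_diff borel_measurable_scaleR borel_measurable_indicator)
      (use \<open>s \<le> t\<close> in \<open>auto intro!: eventually_mono[OF AE_lborel_singleton[of s]] simp: indicator_def\<close>)
  finally show ?thesis .
qed

text \<open>Continuity supplies the right-continuous distribution function that
  \<open>interval_measure\<close> asks for, and later lets rational times approach an arbitrary one
  along a curve.\<close>

lemma isCont_set_integral_atMost:
  fixes f :: "real \<Rightarrow> real"
  assumes f: "integrable lborel f"
  shows "isCont (\<lambda>t. LINT r:{..t}|lborel. f r) t"
  unfolding isCont_def tendsto_at_iff_sequentially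
proof (intro allI impI)
  fix X :: "nat \<Rightarrow> real" assume "X \<longlonglongrightarrow> t"
  have "(\<lambda>n. LINT r|lborel. indicator {..X n} r *\<^sub>R f r) \<longlonglongrightarrow> (LINT r|lborel. indicator {..t} r *\<^sub>R f r)"
  proof (rule integral_dominated_convergence[where w="\<lambda>r. norm (f r)"])
    show "AE r in lborel. (\<lambda>n. indicator {..X n} r *\<^sub>R f r) \<longlonglongrightarrow> indicator {..t} r *\<^sub>R f r"
      using AE_lborel_singleton[of t]
    proof eventually_elim
      fix r assume "r \<noteq> t"
      have "\<forall>\<^sub>F n in sequentially. indicator {..X n} r *\<^sub>R f r = indicator {..t} r *\<^sub>R f r"
      proof (cases "r < t")
        case True
        show ?thesis by (rule eventually_mono[OF order_tendstoD(1)[OF \<open>X \<longlonglongrightarrow> t\<close> True]])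
          (use True in \<open>auto simp: indicator_def\<close>)
      next
        case False
        then have "t < r" using \<open>r \<noteq> t\<close> by simp
        show ?thesis by (rule eventually_mono[OF order_tendstoD(2)[OF \<open>X \<longlonglongrightarrow> t\<close> \<open>t < r\<close>]])
          (use \<open>t < r\<close> in \<open>auto simp: indicator_def\<close>)
      qed
      then show "(\<lambda>n. indicator {..X n} r *\<^sub>R f r) \<longlonglongrightarrow> indicator {..t} r *\<^sub>R f r"
        by (rule tendsto_eventually)
    qed
  qed (use f in \<open>auto simp: indicator_def\<close>)
  then show "((\<lambda>t. LINT r:{..t}|lborel. f r) \<circ> X) \<longlonglongrightarrow> (LINT r:{..t}|lborel. f r)"
    by (simp add: set_lebesgue_integral_def comp_def)
qed

lemma nn_integral_indicator_eq_set_integral: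
  fixes f :: "real \<Rightarrow> real"
  assumes f: "integrable lborel f" "\<And>x. 0 \<le> f x" and A: "A \<in> sets borel"
  shows "(\<integral>\<^sup>+x. ennreal (f x) * indicator A x \<partial>lborel) = ennreal (LINT x:A|lborel. f x)"
proof -
  have "(\<integral>\<^sup>+x. ennreal (f x) * indicator A x \<partial>lborel) = (\<integral>\<^sup>+x. ennreal (indicator A x *\<^sub>R f x) \<partial>lborel)"
    by (intro nn_integral_cong) (auto simp: indicator_def)
  also have "\<dots> = ennreal (LINT x:A|lborel. f x)"
    unfolding set_lebesgue_integral_def
    using f A by (intro nn_integral_eq_integral integrable_mult_indicator) auto
  finally show ?thesis .
qed

text \<open>The two Stieltjes measures of \<open>M + \<rho>\<close> and \<open>M - \<rho>\<close>, with \<open>M\<close> a primitive of \<open>m\<close>, add up to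
  \<open>2 m\<close> times the Lebesgue measure, so both have a density.\<close>

lemma absolutely_continuous_imp_integral:
  fixes \<rho> m :: "real \<Rightarrow> real"
  assumes m: "integrable lborel m" and m0: "\<And>x. 0 \<le> m x"
    and bound: "\<And>s t. s \<le> t \<Longrightarrow> \<bar>\<rho> t - \<rho> s\<bar> \<le> (LINT r:{s..t}|lborel. m r)"
  obtains h where "integrable lborel h"
    "\<And>s t. s \<le> t \<Longrightarrow> \<rho> t - \<rho> s = (LINT r:{s..t}|lborel. h r)"
proof -
  define M where "M t = (LINT r:{..t}|lborel. m r)" for t
  have M: "M t - M s = (LINT r:{s..t}|lborel. m r)" if "s \<le> t" for s t
    unfolding M_def by (rule set_integral_atMost_diff[OF m that])
  have Mc: "isCont M t" for t unfolding M_def by (rule isCont_set_integral_atMost[OF m])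
  have b: "\<bar>\<rho> t - \<rho> s\<bar> \<le> \<bar>M t - M s\<bar>" for s t
    using bound[of s t] bound[of t s] M[of s t] M[of t s] by linarith
  have rc: "isCont \<rho> t" for t
    unfolding isCont_def
  proof (rule LIM_zero_cancel)
    show "((\<lambda>s. \<rho> s - \<rho> t) \<longlongrightarrow> 0) (at t)"
      by (rule Lim_null_comparison[where g="\<lambda>s. \<bar>M s - M t\<bar>"])
        (use b Mc[of t] in \<open>auto simp: isCont_def intro!: tendsto_rabs_zero LIM_zero\<close>)
  qed
  define N where "N c = interval_measure (\<lambda>t. M t + c * \<rho> t)" for c
  have mono: "M s + c * \<rho> s \<le> M t + c * \<rho> t" if "\<bar>c\<bar> = 1" "s \<le> t" for s t c
  proof -
    have "c = 1 \<or> c = -1" using \<open>\<bar>c\<bar> = 1\<close> by linarith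
    then show ?thesis using bound[OF that(2)] M[OF that(2)] by auto
  qed
  have N_Ioc: "emeasure (N c) {a<..b} = ennreal ((M b + c * \<rho> b) - (M a + c * \<rho> a))"
    if "\<bar>c\<bar> = 1" "a \<le> b" for a b c
    unfolding N_def
  proof (rule emeasure_interval_measure_Ioc[OF \<open>a \<le> b\<close>])
    show "M s + c * \<rho> s \<le> M t + c * \<rho> t" if "s \<le> t" for s t
      by (rule mono) fact+
    have "isCont (\<lambda>t. M t + c * \<rho> t) t" for t
      by (intro continuous_intros Mc rc)
    then show "continuous (at_right t) (\<lambda>t. M t + c * \<rho> t)" for t
      by (rule continuous_at_imp_continuous_within)
  qed
  have sets_N[simp]: "sets (N c) = sets borel" for c by (simp add: N_def)
  define N2 where "N2 = measure_of UNIV (sets borel) (\<lambda>A. emeasure (N 1) A + emeasure (N (-1)) A)"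
  have N2: "emeasure N2 A = emeasure (N 1) A + emeasure (N (-1)) A" if "A \<in> sets borel" for A
    unfolding N2_def
  proof (rule emeasure_measure_of_sigma)
    show "sigma_algebra UNIV (sets (borel :: real measure))"
      using sets.sigma_algebra_axioms[of "borel :: real measure"] by simp
    show "positive (sets borel) (\<lambda>A. emeasure (N 1) A + emeasure (N (- 1)) A)"
      by (simp add: positive_def)
    show "countably_additive (sets borel) (\<lambda>A. emeasure (N 1) A + emeasure (N (- 1)) A)"
      by (auto simp: countably_additive_def suminf_add[symmetric] suminf_emeasure)
  qed fact
  have sets_N2[simp]: "sets N2 = sets borel"
    unfolding N2_def using sets.sigma_sets_eq[of "borel :: real measure"] by (subst sets_measure_of) auto
  let ?D = "density lborel (\<lambda>x. ennreal (2 * m x))"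
  have D: "emeasure ?D A = ennreal (2 * (LINT x:A|lborel. m x))" if "A \<in> sets borel" for A
    using m that m0 nn_integral_indicator_eq_set_integral[of "\<lambda>x. 2 * m x" A]
    by (subst emeasure_density) auto
  \<comment> \<open>Half-open intervals generate the Borel sets and are stable under intersection;
    on them the contributions of \<rho> cancel.\<close>
  have "N2 = ?D"
  proof (rule measure_eqI_generator_eq[where \<Omega>=UNIV and E="range (\<lambda>(a, b). {a<..b})" and A="\<lambda>i::nat. {- real i<..real i}"])
    show "Int_stable (range (\<lambda>(a, b). {a<..b::real}))"
      by (auto simp: Int_stable_def)
    show "sets N2 = sigma_sets UNIV (range (\<lambda>(a, b). {a<..b::real}))"
      by (simp add: borel_sigma_sets_Ioc)
    show "sets ?D = sigma_sets UNIV (range (\<lambda>(a, b). {a<..b::real}))"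
      by (simp add: borel_sigma_sets_Ioc)
    fix X assume "X \<in> range (\<lambda>(a, b). {a<..b::real})"
    then obtain a b where X: "X = {a<..b}" by auto
    show "emeasure N2 X = emeasure ?D X"
    proof (cases "a \<le> b")
      case True
      have "(LINT x:{a<..b}|lborel. m x) = M b - M a"
        unfolding M[OF True] set_lebesgue_integral_def using m
        by (intro integral_cong_AE borel_measurable_scaleR borel_measurable_indicator)
          (use True in \<open>auto intro!: eventually_mono[OF AE_lborel_singleton[of a]] simp: indicator_def\<close>)
      then show ?thesis
        using N_Ioc[OF _ True, of 1] N_Ioc[OF _ True, of "-1"] mono[OF _ True, of 1] mono[OF _ True, of "-1"]
        by (simp add: X D N2 flip: ennreal_plus)
    qed (auto simp: X)
  next
    show "(\<Union>i::nat. {- real i<..real i}) = UNIV"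
    proof (safe, simp_all)
      fix x :: real
      obtain n :: nat where "\<bar>x\<bar> < real n" using reals_Archimedean2 by blast
      then show "\<exists>n. - real n < x \<and> x \<le> real n" by (intro exI[of _ n]) auto
    qed
    show "emeasure N2 {- real i<..real i} \<noteq> \<infinity>" for i
      using N_Ioc[of 1 "- real i" "real i"] N_Ioc[of "-1" "- real i" "real i"] by (simp add: N2)
  qed auto
  \<comment> \<open>The other summand is nonnegative, so \<open>N 1\<close> is dominated by a finite
    measure with a density. This gives its absolute continuity and the integrability of its
    Radon-Nikodym derivative.\<close>
  then have le: "emeasure (N 1) A \<le> emeasure ?D A" if "A \<in> sets borel" for A
    unfolding \<open>N2 = ?D\<close>[symmetric] N2[OF that] by simp
  have "absolutely_continuous lborel (N 1)"
    unfolding absolutely_continuous_def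
  proof
    fix A :: "real set" assume A: "A \<in> null_sets lborel"
    then have "emeasure ?D A = 0"
      using absolutely_continuousI_density[of "\<lambda>x. ennreal (2 * m x)" lborel] m
      unfolding absolutely_continuous_def by (auto simp: null_sets_def)
    then show "A \<in> null_sets (N 1)" using le[of A] A by (auto simp: null_sets_def)
  qed
  then obtain f where f: "f \<in> borel_measurable lborel" "density lborel f = N 1"
    using sigma_finite_measure.Radon_Nikodym[OF sigma_finite_lborel, of "N 1"] by auto
  have [measurable]: "f \<in> borel_measurable borel" using f by simp
  have em: "emeasure (N 1) A = (\<integral>\<^sup>+x. f x * indicator A x \<partial>lborel)" if "A \<in> sets borel" for A
    unfolding f(2)[symmetric] using that by (subst emeasure_density) auto
  have "(\<integral>\<^sup>+x. f x \<partial>lborel) \<le> emeasure ?D UNIV"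
    using le[of UNIV] em[of UNIV] by simp
  also have "\<dots> < \<infinity>" by (simp add: D)
  finally have fin: "(\<integral>\<^sup>+x. f x \<partial>lborel) \<noteq> \<infinity>" by simp
  then have AEf: "AE x in lborel. f x \<noteq> \<infinity>" by (intro nn_integral_PInf_AE) auto
  have f_eq: "AE x in lborel. ennreal (enn2real (f x)) = f x"
    using AEf by eventually_elim (simp add: less_top)
  have fi: "integrable lborel (\<lambda>x. enn2real (f x))"
    unfolding integrable_iff_bounded
    using fin nn_integral_cong_AE[OF f_eq] by (simp add: less_top[symmetric])
  show thesis
  proof (rule that)
    \<comment> \<open>\<open>N 1\<close> represents M + \<rho>, so m is subtracted from its
      density.\<close>
    show "integrable lborel (\<lambda>x. enn2real (f x) - m x)" using fi m by simp
    fix s t :: real assume st: "s \<le> t"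
    have "ennreal (LINT x:{s..t}|lborel. enn2real (f x)) = (\<integral>\<^sup>+x. ennreal (enn2real (f x)) * indicator {s..t} x \<partial>lborel)"
      using fi by (intro nn_integral_indicator_eq_set_integral[symmetric]) auto
    also have "\<dots> = (\<integral>\<^sup>+x. f x * indicator {s<..t} x \<partial>lborel)"
    proof (rule nn_integral_cong_AE)
      show "AE x in lborel. ennreal (enn2real (f x)) * indicator {s..t} x = f x * indicator {s<..t} x"
        using f_eq AE_lborel_singleton[of s] by eventually_elim (auto simp: indicator_def)
    qed
    also have "\<dots> = ennreal ((M t + \<rho> t) - (M s + \<rho> s))"
      using em[of "{s<..t}"] N_Ioc[OF _ st, of 1] by simp
    finally have "(LINT x:{s..t}|lborel. enn2real (f x)) = (M t + \<rho> t) - (M s + \<rho> s)"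
      using mono[OF _ st, of 1] by (subst (asm) ennreal_inj) (auto simp: set_lebesgue_integral_def)
    then show "\<rho> t - \<rho> s = (LINT r:{s..t}|lborel. enn2real (f r) - m r)"
      using M[OF st] by (subst set_integral_diff(2)) (auto intro!: set_integrable_interval fi m)
  qed
qed

section \<open>The metric derivative\<close>

text \<open>The metric derivative is the supremum of the derivatives of the distances to a countable
  dense set of points of the curve.\<close>

lemma metric_derivative_exists:
  fixes v :: "real \<Rightarrow> 'a" and d :: "'a \<Rightarrow> 'a \<Rightarrow> real" and m :: "real \<Rightarrow> real"
  assumes S: "Metric_space S d" and vS: "\<And>t. v t \<in> S"
    and m: "integrable lborel m" "\<And>x. 0 \<le> m x"
    and bound: "\<And>s t. s \<le> t \<Longrightarrow> d (v s) (v t) \<le> (LINT r:{s..t}|lborel. m r)"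
  obtains f where "integrable lborel f" "\<And>x. 0 \<le> f x"
    "AE x in lborel. ((\<lambda>s. d (v x) (v s) / \<bar>x - s\<bar>) \<longlongrightarrow> f x) (at x)"
    "\<And>s t. s \<le> t \<Longrightarrow> d (v s) (v t) \<le> (LINT r:{s..t}|lborel. f r)"
proof -
  interpret Metric_space S d by fact
  define M where "M t = (LINT r:{..t}|lborel. m r)" for t
  have M: "M t - M s = (LINT r:{s..t}|lborel. m r)" if "s \<le> t" for s t
    unfolding M_def by (rule set_integral_atMost_diff[OF m(1) that])
  have Mc: "isCont M t" for t unfolding M_def by (rule isCont_set_integral_atMost[OF m(1)])
  have dM: "d (v s) (v t) \<le> \<bar>M t - M s\<bar>" for s t
    using bound[of s t] bound[of t s] M[of s t] M[of t s] commute[of "v s" "v t"] by linarith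
  define \<rho> where "\<rho> q t = d (v t) (v (of_rat q))" for q :: rat and t
  have rd: "\<bar>\<rho> q t - \<rho> q s\<bar> \<le> d (v s) (v t)" for q s t
    using mdist_reverse_triangle[of "v t" "v (of_rat q)" "v s"] triangle[of "v t" "v s" "v (of_rat q)"]
       triangle[of "v s" "v t" "v (of_rat q)"] commute[of "v s" "v t"]
    by (auto simp: \<rho>_def vS abs_le_iff)
  have "\<exists>h. integrable lborel h \<and> (\<forall>s t. s \<le> t \<longrightarrow> \<rho> q t - \<rho> q s = (LINT r:{s..t}|lborel. h r))" for q
  proof -
    have "\<bar>\<rho> q t - \<rho> q s\<bar> \<le> (LINT r:{s..t}|lborel. m r)" if "s \<le> t" for s t
      using rd[of q t s] bound[OF that] by linarith
    from absolutely_continuous_imp_integral[OF m this] show ?thesis by metis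
  qed
  then obtain h where h: "\<And>q. integrable lborel (h q)"
    "\<And>q s t. s \<le> t \<Longrightarrow> \<rho> q t - \<rho> q s = (LINT r:{s..t}|lborel. h q r)"
    by metis
  have [measurable]: "h q \<in> borel_measurable borel" "m \<in> borel_measurable borel" for q using h(1)[of q] m by auto
  have "AE x in lborel. (M has_real_derivative m x) (at x)"
    by (rule lebesgue_differentiation[OF m(1) M])
  moreover have hd: "AE x in lborel. \<forall>q. (\<rho> q has_real_derivative h q x) (at x)"
    by (subst AE_all_countable) (auto intro: lebesgue_differentiation[OF h(1,2)])
  ultimately have hm: "AE x in lborel. \<forall>q. \<bar>h q x\<bar> \<le> m x"
  proof eventually_elim
    fix x assume 1: "(M has_real_derivative m x) (at x)" and 2: "\<forall>q. (\<rho> q has_real_derivative h q x) (at x)"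
    show "\<forall>q. \<bar>h q x\<bar> \<le> m x"
    proof
      fix q
      have "\<bar>h q x\<bar> \<le> \<bar>m x\<bar>"
      proof (rule tendsto_le)
        show "((\<lambda>y. \<bar>(M y - M x) / (y - x)\<bar>) \<longlongrightarrow> \<bar>m x\<bar>) (at x)"
          using 1 by (intro tendsto_rabs) (simp add: has_field_derivative_iff)
        show "((\<lambda>y. \<bar>(\<rho> q y - \<rho> q x) / (y - x)\<bar>) \<longlongrightarrow> \<bar>h q x\<bar>) (at x)"
          using 2 by (intro tendsto_rabs) (simp add: has_field_derivative_iff)
        show "\<forall>\<^sub>F y in at x. \<bar>(\<rho> q y - \<rho> q x) / (y - x)\<bar> \<le> \<bar>(M y - M x) / (y - x)\<bar>"
          using order_trans[OF rd dM] by (intro always_eventually) (auto simp: abs_divide intro!: divide_right_mono)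
      qed simp
      then show "\<bar>h q x\<bar> \<le> m x" using m(2)[of x] by simp
    qed
  qed
  \<comment> \<open>The minimum with m keeps the supremum bounded, hence a genuine real supremum, at
    every x; by \<open>hm\<close> it alters the terms only on a null set.\<close>
  define f where "f x = (SUP q. min \<bar>h q x\<bar> (m x))" for x
  have bdd: "bdd_above (range (\<lambda>q. min \<bar>h q x\<bar> (m x)))" for x
    by (rule bdd_aboveI[of _ "m x"]) auto
  have f_ub: "min \<bar>h q x\<bar> (m x) \<le> f x" for q x
    unfolding f_def by (rule cSUP_upper[OF _ bdd]) simp
  have f0: "0 \<le> f x" for x using f_ub[of 0 x] m(2)[of x] by linarith
  have fm: "f x \<le> m x" for x unfolding f_def by (rule cSUP_least) auto
  have [measurable]: "f \<in> borel_measurable borel"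
    unfolding f_def by (rule borel_measurable_cSUP) (auto intro: bdd)
  have fi: "integrable lborel f"
    by (rule Bochner_Integration.integrable_bound[OF m(1)]) (use f0 fm m(2) in auto)
  have hf: "AE x in lborel. \<forall>q. \<bar>h q x\<bar> \<le> f x"
    using hm by eventually_elim (metis f_ub min.absorb1)
  have df: "d (v s) (v t) \<le> (LINT r:{s..t}|lborel. f r)" (is "_ \<le> ?I") if st: "s \<le> t" for s t
  proof (rule field_le_epsilon)
    fix e :: real assume "e > 0"
    then obtain \<delta> where de: "\<delta> > 0" "\<And>y. \<bar>y - s\<bar> < \<delta> \<Longrightarrow> \<bar>M y - M s\<bar> < e / 2"
      using Mc[of s] unfolding continuous_at_eps_delta dist_real_def by (metis half_gt_zero)
    \<comment> \<open>A rational time just after s. Replacing v s by the point at time q costs less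
      than e / 2 twice: once in the triangle inequality and once as the value of \<rho> at
      s.\<close>
    obtain q where q: "s < of_rat q" "of_rat q < s + \<delta>"
      using of_rat_dense[of s "s + \<delta>"] de by auto
    then have small: "d (v s) (v (of_rat q)) < e / 2"
      using de(2)[of "of_rat q"] dM[of s "of_rat q"] by auto
    have "\<bar>\<rho> q t - \<rho> q s\<bar> \<le> (LINT r:{s..t}|lborel. \<bar>h q r\<bar>)"
      using h(2)[OF st, of q] set_integral_norm_bound[OF set_integrable_interval[OF h(1)[of q]], of s t]
      by simp
    also have "\<dots> \<le> ?I"
      using hf h(1)[of q] fi unfolding set_lebesgue_integral_def
      by (intro integral_mono_AE integrable_mult_indicator)
        (auto elim!: eventually_mono simp: indicator_def)
    finally have "\<bar>\<rho> q t - \<rho> q s\<bar> \<le> ?I" .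
    then show "d (v s) (v t) \<le> ?I + e"
      using small triangle[of "v s" "v (of_rat q)" "v t"] commute[of "v (of_rat q)" "v t"]
      by (auto simp: \<rho>_def vS abs_le_iff)
  qed
  define F where "F t = (LINT r:{..t}|lborel. f r)" for t
  have F: "F t - F s = (LINT r:{s..t}|lborel. f r)" if "s \<le> t" for s t
    unfolding F_def by (rule set_integral_atMost_diff[OF fi that])
  have dF: "d (v s) (v t) \<le> \<bar>F t - F s\<bar>" for s t
    using df[of s t] df[of t s] F[of s t] F[of t s] commute[of "v s" "v t"] by linarith
  have "AE x in lborel. (F has_real_derivative f x) (at x)"
    by (rule lebesgue_differentiation[OF fi F])
  then have "AE x in lborel. ((\<lambda>s. d (v x) (v s) / \<bar>x - s\<bar>) \<longlongrightarrow> f x) (at x)"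
    using hd hm
  proof eventually_elim
    fix x assume Fd: "(F has_real_derivative f x) (at x)"
      and hd: "\<forall>q. (\<rho> q has_real_derivative h q x) (at x)" and hm: "\<forall>q. \<bar>h q x\<bar> \<le> m x"
    \<comment> \<open>The quotient lies above that of every distance function \<rho>, by the reverse
      triangle inequality, and below that of the primitive F; the supremum of the lower limits and
      the upper limit are both f x.\<close>
    show "((\<lambda>s. d (v x) (v s) / \<bar>x - s\<bar>) \<longlongrightarrow> f x) (at x)"
    proof (rule order_tendstoI)
      fix a assume "a < f x"
      then obtain q where "a < min \<bar>h q x\<bar> (m x)"
        unfolding f_def using less_cSUP_iff[OF _ bdd, of a x] by auto
      then have "a < \<bar>h q x\<bar>" by simp
      moreover have "((\<lambda>y. \<bar>(\<rho> q y - \<rho> q x) / (y - x)\<bar>) \<longlongrightarrow> \<bar>h q x\<bar>) (at x)"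
        using hd by (intro tendsto_rabs) (simp add: has_field_derivative_iff)
      ultimately have "\<forall>\<^sub>F y in at x. a < \<bar>(\<rho> q y - \<rho> q x) / (y - x)\<bar>"
        by (metis order_tendstoD(1))
      then show "\<forall>\<^sub>F s in at x. a < d (v x) (v s) / \<bar>x - s\<bar>"
      proof eventually_elim
        fix y assume "a < \<bar>(\<rho> q y - \<rho> q x) / (y - x)\<bar>"
        also have "\<dots> \<le> d (v x) (v y) / \<bar>x - y\<bar>"
          using rd[of q y x] by (auto simp: abs_divide abs_minus_commute intro!: divide_right_mono)
        finally show "a < d (v x) (v y) / \<bar>x - y\<bar>" .
      qed
    next
      fix a assume "f x < a"
      moreover have "((\<lambda>y. \<bar>(F y - F x) / (y - x)\<bar>) \<longlongrightarrow> \<bar>f x\<bar>) (at x)"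
        using Fd by (intro tendsto_rabs) (simp add: has_field_derivative_iff)
      ultimately have "\<forall>\<^sub>F y in at x. \<bar>(F y - F x) / (y - x)\<bar> < a"
        using f0[of x] by (auto dest: order_tendstoD(2))
      then show "\<forall>\<^sub>F s in at x. d (v x) (v s) / \<bar>x - s\<bar> < a"
      proof eventually_elim
        fix y assume a: "\<bar>(F y - F x) / (y - x)\<bar> < a"
        have "d (v x) (v y) / \<bar>x - y\<bar> \<le> \<bar>(F y - F x) / (y - x)\<bar>"
          using dF[of x y] by (auto simp: abs_divide abs_minus_commute intro!: divide_right_mono)
        then show "d (v x) (v y) / \<bar>x - y\<bar> < a" using a by linarith
      qed
    qed
  qed
  then show thesis using that fi f0 df by blast
qed

section \<open>Powers and difference quotients\<close>

lemma ennreal_powr_ennreal: "0 \<le> y \<Longrightarrow> ennreal_powr (ennreal y) p = ennreal (y powr p)"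
  by (simp add: ennreal_powr_def)

text \<open>Moves a strict lower bound from a power to its base, infinite base included. This is the
  form in which \<open>le_Liminf_iff\<close> tests lower limits.\<close>

lemma less_ennreal_powr_iff:
  assumes "0 < p" "0 \<le> z"
  shows "ennreal z < ennreal_powr x p \<longleftrightarrow> ennreal (z powr (1 / p)) < x"
proof (cases x)
  case (real y)
  have "z < y powr p \<longleftrightarrow> z powr (1 / p) < y"
  proof
    assume "z < y powr p"
    then have "z powr (1 / p) < (y powr p) powr (1 / p)"
      using assms by (intro powr_less_mono2) auto
    then show "z powr (1 / p) < y" using assms real by (simp add: powr_powr)
  next
    assume "z powr (1 / p) < y"
    then have "(z powr (1 / p)) powr p < y powr p"
      using assms by (intro powr_less_mono2) auto
    then show "z < y powr p" using assms by (simp add: powr_powr)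
  qed
  then show ?thesis using real assms by (simp add: ennreal_powr_ennreal ennreal_less_iff)
qed (simp add: ennreal_powr_def)

lemma ennreal_powr_liminf:
  assumes "0 < p" and "x \<le> liminf y"
  shows "ennreal_powr x p \<le> liminf (\<lambda>k. ennreal_powr (y k) p)"
  unfolding le_Liminf_iff
proof (intro allI impI)
  fix z assume z: "z < ennreal_powr x p"
  then obtain z' where z': "z = ennreal z'" "0 \<le> z'"
    by (cases z) auto
  then have "ennreal (z' powr (1 / p)) < x" using z assms(1) by (simp add: less_ennreal_powr_iff)
  then have "\<forall>\<^sub>F k in sequentially. ennreal (z' powr (1 / p)) < y k"
    using assms(2) unfolding le_Liminf_iff by auto
  then show "\<forall>\<^sub>F k in sequentially. z < ennreal_powr (y k) p"
    by eventually_elim (use z' assms(1) in \<open>simp add: less_ennreal_powr_iff\<close>)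
qed

lemma measurable_ennreal_powr[measurable]:
  assumes [measurable]: "f \<in> borel_measurable M"
  shows "(\<lambda>x. ennreal_powr (f x) p) \<in> borel_measurable M"
proof -
  have [measurable]: "Measurable.pred M (\<lambda>x. f x = \<infinity>)"
    using measurable_sets[OF assms, of "{\<infinity>}"] by (simp add: pred_def vimage_def Int_def conj_commute)
  show ?thesis unfolding ennreal_powr_def by (intro measurable_If) measurable
qed

lemma ennreal_powr_real_liminf:
  assumes "0 < p" "0 \<le> x" "\<And>k. 0 \<le> y k" "ereal x \<le> liminf (\<lambda>k. ereal (y k))"
  shows "ennreal (x powr p) \<le> liminf (\<lambda>k. ennreal (y k powr p))"
proof -
  have "ennreal x \<le> liminf (\<lambda>k. ennreal (y k))"
    unfolding le_Liminf_iff
  proof (intro allI impI)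
    fix z assume "z < ennreal x"
    then obtain z' where z': "z = ennreal z'" "0 \<le> z'" "z' < x"
      by (cases z) (auto simp: ennreal_less_iff)
    then have "ereal z' < ereal x" by simp
    with assms(4) have "\<forall>\<^sub>F k in sequentially. ereal z' < ereal (y k)"
      unfolding le_Liminf_iff by blast
    then show "\<forall>\<^sub>F k in sequentially. z < ennreal (y k)"
      by eventually_elim (use z' in \<open>auto simp: ennreal_less_iff\<close>)
  qed
  from ennreal_powr_liminf[OF assms(1) this] show ?thesis
    using assms(2,3) by (simp add: ennreal_powr_ennreal)
qed

text \<open>Convexity of the power as a tangent line at a. Young's inequality for x and a^(p - 1)
  yields it without differentiating, so a = 0 needs no separate limit.\<close>

lemma powr_tangent_le:
  fixes a x p :: real
  assumes "1 < p" "0 \<le> a" "0 \<le> x"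
  shows "a powr p + p * a powr (p - 1) * (x - a) \<le> x powr p"
proof -
  define q where "q = p / (p - 1)"
  have q: "1 < q" "1 / p + 1 / q = 1" "(p - 1) * q = p" "p / q = p - 1"
    using assms(1) by (auto simp: q_def field_simps)
  have "x * a powr (p - 1) \<le> x powr p / p + (a powr (p - 1)) powr q / q"
    using assms q by (intro Youngs_inequality) auto
  also have "(a powr (p - 1)) powr q = a powr p" by (simp add: powr_powr q)
  finally have "p * (x * a powr (p - 1)) \<le> p * (x powr p / p + a powr p / q)"
    using assms(1) by (intro mult_left_mono) auto
  also have "\<dots> = x powr p + (p - 1) * a powr p"
    using assms(1) by (simp add: distrib_left flip: q(4))
  finally have *: "p * (x * a powr (p - 1)) \<le> x powr p + (p - 1) * a powr p" .
  have "a * a powr (p - 1) = a powr p"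
    using assms by (cases "a = 0") (auto simp: powr_diff)
  then have "p * a powr (p - 1) * (x - a) = p * (x * a powr (p - 1)) - p * a powr p"
    by (metis (no_types, opaque_lifting) mult.assoc mult.commute right_diff_distrib')
  then show ?thesis using * by (simp add: left_diff_distrib)
qed

text \<open>Jensen's inequality, scaled by the length of the interval: in the integral of the
  tangent at the mean value \<open>a\<close> the linear term vanishes.\<close>

lemma powr_integral_le:
  fixes f :: "real \<Rightarrow> real"
  assumes f: "integrable lborel f" "\<And>x. 0 \<le> f x" and "s < t" "1 < p"
  shows "ennreal ((LINT r:{s..t}|lborel. f r) powr p) \<le>
     ennreal ((t - s) powr (p - 1)) * (\<integral>\<^sup>+r\<in>{s..t}. ennreal (f r powr p) \<partial>lborel)"
proof (cases "(\<integral>\<^sup>+r\<in>{s..t}. ennreal (f r powr p) \<partial>lborel) = \<infinity>")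
  case True
  then show ?thesis using assms(3,4) by (simp add: ennreal_mult_top)
next
  case False
  have [measurable]: "f \<in> borel_measurable borel" using f by auto
  define I where "I = (LINT r:{s..t}|lborel. f r)"
  define a where "a = I / (t - s)"
  have I0: "0 \<le> I" unfolding I_def set_lebesgue_integral_def
    by (intro integral_nonneg_AE) (use f in auto)
  then have a0: "0 \<le> a" using \<open>s < t\<close> by (simp add: a_def)
  have nneq: "(\<integral>\<^sup>+r. ennreal (indicator {s..t} r *\<^sub>R f r powr p) \<partial>lborel) = (\<integral>\<^sup>+r\<in>{s..t}. ennreal (f r powr p) \<partial>lborel)"
    by (intro nn_integral_cong) (auto simp: indicator_def)
  have int: "set_integrable lborel {s..t} (\<lambda>r. f r powr p)"
    unfolding set_integrable_def
    by (rule integrableI_nonneg) (use False nneq in \<open>auto simp: less_top[symmetric]\<close>)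
  have eq: "(\<integral>\<^sup>+r\<in>{s..t}. ennreal (f r powr p) \<partial>lborel) = ennreal (LINT r:{s..t}|lborel. f r powr p)"
    unfolding nneq[symmetric] set_lebesgue_integral_def
    using int by (intro nn_integral_eq_integral) (auto simp: set_integrable_def)
  have "(t - s) * a powr p = (LINT r:{s..t}|lborel. a powr p + p * a powr (p - 1) * (f r - a))"
  proof -
    have i: "set_integrable lborel {s..t} (\<lambda>r. f r - a)"
      by (intro set_integral_diff set_integrable_interval f set_integrable_const_interval)
    have c: "(LINT r:{s..t}|lborel. c) = c * (t - s)" for c :: real
      using \<open>s < t\<close> by (simp add: set_lebesgue_integral_def)
    have "(LINT r:{s..t}|lborel. f r - a) = I - a * (t - s)"
      using c[of a] unfolding I_def
      by (subst set_integral_diff(2)) (intro set_integrable_interval f set_integrable_const_interval | simp)+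
    also have "\<dots> = 0" using \<open>s < t\<close> by (simp add: a_def)
    finally have z: "(LINT r:{s..t}|lborel. p * a powr (p - 1) * (f r - a)) = 0" by simp
    have "(LINT r:{s..t}|lborel. a powr p + p * a powr (p - 1) * (f r - a)) =
       (LINT r:{s..t}|lborel. a powr p) + (LINT r:{s..t}|lborel. p * a powr (p - 1) * (f r - a))"
      by (intro set_integral_add(2) set_integrable_const_interval set_integrable_mult_right i)
    then show ?thesis using z c[of "a powr p"] by simp
  qed
  also have "\<dots> \<le> (LINT r:{s..t}|lborel. f r powr p)"
  proof (rule set_integral_mono)
    show "set_integrable lborel {s..t} (\<lambda>r. a powr p + p * a powr (p - 1) * (f r - a))"
      by (intro set_integral_add(1) set_integral_diff(1) set_integrable_const_interval
            set_integrable_mult_right set_integrable_interval f)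
  qed (use int powr_tangent_le[OF \<open>1 < p\<close> a0 f(2)] in auto)
  finally have "(t - s) powr (p - 1) * ((t - s) * a powr p) \<le> (t - s) powr (p - 1) * (LINT r:{s..t}|lborel. f r powr p)"
    by (intro mult_left_mono) auto
  moreover have "I powr p = (t - s) powr (p - 1) * ((t - s) * a powr p)"
    using \<open>s < t\<close> I0 by (simp add: a_def powr_divide powr_diff)
  ultimately show ?thesis
    unfolding eq I_def[symmetric] by (simp add: ennreal_mult'[symmetric] ennreal_leI)
qed

text \<open>By Fatou's lemma it is enough to bound the integral of V (r + h) - V r by h * (V T - V
  0). Translation by h makes the two parts overlap except near the ends, and beyond T the function
  is constant.\<close>

lemma nn_integral_liminf_difference_quotient:
  fixes V :: "real \<Rightarrow> real" and F :: "real \<Rightarrow> ennreal"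
  assumes V: "mono V" "\<And>t. T \<le> t \<Longrightarrow> V t = V T" and "0 < T"
    and F: "AE r in lborel. 0 < r \<and> r < T \<longrightarrow>
      F r \<le> liminf (\<lambda>n. ennreal ((V (r + 1 / real (Suc n)) - V r) * real (Suc n)))"
  shows "(\<integral>\<^sup>+r\<in>{0..T}. F r \<partial>lborel) \<le> ennreal (V T - V 0)"
proof -
  have [measurable]: "V \<in> borel_measurable borel" by (rule borel_measurable_mono) fact
  have bound: "(\<integral>\<^sup>+r\<in>{0..T}. ennreal (V (r + h) - V r) \<partial>lborel) \<le> ennreal (h * (V T - V 0))" if "0 < h" for h
  proof -
    define W where "W r = ennreal (V r - V 0)" for r
    have [measurable]: "W \<in> borel_measurable borel" unfolding W_def by measurable
    have V_le: "V r \<le> V T" "r \<ge> 0 \<Longrightarrow> V 0 \<le> V r" for r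
      using V(2)[of r] monoD[OF V(1), of r T] monoD[OF V(1), of 0 r] by linarith+
    let ?X = "\<integral>\<^sup>+r\<in>{0..T}. ennreal (V (r + h) - V r) \<partial>lborel" and ?Y = "\<integral>\<^sup>+r\<in>{0..T}. W r \<partial>lborel"
    have "?Y \<le> (\<integral>\<^sup>+r\<in>{0..T}. ennreal (V T - V 0) \<partial>lborel)"
      by (intro nn_integral_mono mult_right_mono) (auto simp: W_def intro!: ennreal_leI V_le)
    also have "\<dots> < \<infinity>" using \<open>0 < T\<close> by (simp add: nn_integral_cmult_indicator ennreal_mult[symmetric] less_top[symmetric] ennreal_mult_eq_top_iff)
    finally have Yfin: "?Y \<noteq> \<infinity>" by simp
    \<comment> \<open>The difference is handled as a sum because \<open>ennreal\<close> subtraction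
      truncates; the finite \<open>?Y\<close> is cancelled at the end. Subtracting V 0 in
      \<open>W\<close> makes the integrand nonnegative on [0, T].\<close>
    have "?Y + ?X = (\<integral>\<^sup>+r\<in>{0..T}. W (h + 1 * r) \<partial>lborel)"
    proof -
      have "?Y + ?X = (\<integral>\<^sup>+r. W r * indicator {0..T} r + ennreal (V (r + h) - V r) * indicator {0..T} r \<partial>lborel)"
        by (rule nn_integral_add[symmetric]) measurable
      also have "\<dots> = (\<integral>\<^sup>+r\<in>{0..T}. W (h + 1 * r) \<partial>lborel)"
      proof (rule nn_integral_cong)
        fix r
        have "W r + ennreal (V (r + h) - V r) = W (h + 1 * r)" if "0 \<le> r"
          unfolding W_def using V_le(2)[OF that] monoD[OF V(1), of r "r + h"] \<open>0 < h\<close>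
          by (subst ennreal_plus[symmetric]) (auto simp: add.commute)
        then show "W r * indicator {0..T} r + ennreal (V (r + h) - V r) * indicator {0..T} r =
            W (h + 1 * r) * indicator {0..T} r"
          by (cases "r \<in> {0..T}") auto
      qed
      finally show ?thesis .
    qed
    also have "\<dots> = (\<integral>\<^sup>+r. W r * indicator {h..T + h} r \<partial>lborel)"
      by (subst nn_integral_real_affine[where c=1 and t=h and f="\<lambda>r. W r * indicator {h..T + h} r"])
        (auto intro!: nn_integral_cong simp: indicator_def)
    also have "\<dots> \<le> (\<integral>\<^sup>+r. W r * indicator {0..T} r + ennreal (V T - V 0) * indicator {T..T+h} r \<partial>lborel)"
    proof (rule nn_integral_mono)
      fix r
      have "W r * indicator {h..T + h} r \<le> W r * indicator {0..T} r + W r * indicator {T..T+h} r"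
        using \<open>0 < h\<close> by (auto simp: indicator_def)
      moreover have "W r * indicator {T..T+h} r = ennreal (V T - V 0) * indicator {T..T+h} r"
      proof (cases "r \<in> {T..T+h}")
        case True
        then have "V r = V T" using V(2)[of r] by simp
        then show ?thesis by (simp only: W_def)
      next
        case False
        then have "indicator {T..T+h} r = (0::ennreal)" by (rule indicator_simps(2))
        then show ?thesis by (simp only: mult_zero_right)
      qed
      ultimately show "W r * indicator {h..T + h} r \<le> W r * indicator {0..T} r + ennreal (V T - V 0) * indicator {T..T+h} r"
        by simp
    qed
    also have "\<dots> = ?Y + ennreal (V T - V 0) * ennreal h"
      using \<open>0 < h\<close> by (subst nn_integral_add) (auto simp: nn_integral_cmult_indicator)
    finally have "?X \<le> ennreal (V T - V 0) * ennreal h"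
      using Yfin by (simp add: ennreal_add_left_cancel_le)
    then show ?thesis using \<open>0 < h\<close> V_le(1)[of 0] by (simp add: ennreal_mult[symmetric] mult.commute)
  qed
  let ?Q = "\<lambda>n r. ennreal ((V (r + 1 / real (Suc n)) - V r) * real (Suc n))"
  have "(\<integral>\<^sup>+r\<in>{0..T}. F r \<partial>lborel) \<le> (\<integral>\<^sup>+r. liminf (\<lambda>n. ?Q n r * indicator {0..T} r) \<partial>lborel)"
  proof (rule nn_integral_mono_AE)
    show "AE r in lborel. F r * indicator {0..T} r \<le> liminf (\<lambda>n. ?Q n r * indicator {0..T} r)"
      using F AE_lborel_singleton[of 0] AE_lborel_singleton[of T]
      by eventually_elim (auto simp: indicator_def)
  qed
  also have "\<dots> \<le> liminf (\<lambda>n. \<integral>\<^sup>+r. ?Q n r * indicator {0..T} r \<partial>lborel)"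
    by (rule nn_integral_liminf) measurable
  also have "\<dots> \<le> liminf (\<lambda>n. ennreal (V T - V 0))"
  proof (intro Liminf_mono always_eventually allI)
    fix n
    have "(\<integral>\<^sup>+r. ?Q n r * indicator {0..T} r \<partial>lborel) =
       (\<integral>\<^sup>+r. ennreal (real (Suc n)) * (ennreal (V (r + 1 / real (Suc n)) - V r) * indicator {0..T} r) \<partial>lborel)"
      using monoD[OF V(1)] by (intro nn_integral_cong) (auto simp: ennreal_mult' ac_simps simp del: of_nat_Suc)
    also have "\<dots> = ennreal (real (Suc n)) * (\<integral>\<^sup>+r\<in>{0..T}. ennreal (V (r + 1 / real (Suc n)) - V r) \<partial>lborel)"
      by (intro nn_integral_cmult) auto
    also have "\<dots> \<le> ennreal (real (Suc n)) * ennreal (1 / real (Suc n) * (V T - V 0))"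
      by (intro mult_left_mono bound) auto
    also have "\<dots> = ennreal (V T - V 0)"
      by (subst ennreal_mult'[symmetric]) (auto simp del: of_nat_Suc)
    finally show "(\<integral>\<^sup>+r. ?Q n r * indicator {0..T} r \<partial>lborel) \<le> ennreal (V T - V 0)" .
  qed
  also have "\<dots> = ennreal (V T - V 0)" by (simp add: Liminf_const)
  finally show ?thesis .
qed

section \<open>Absolutely continuous curves on the half-line\<close>

lemma set_integrable_abs_of_powr:
  fixes m :: "real \<Rightarrow> real"
  assumes m: "set_borel_measurable lborel {a..b} m" "set_integrable lborel {a..b} (\<lambda>r. \<bar>m r\<bar> powr p)"
    and "1 \<le> p"
  shows "integrable lborel (\<lambda>r. \<bar>indicator {a..b} r * m r\<bar>)"
proof (rule Bochner_Integration.integrable_bound)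
  show "integrable lborel (\<lambda>r. indicator {a..b} r *\<^sub>R (1 + \<bar>m r\<bar> powr p))"
    using set_integral_add(1)[OF set_integrable_const_interval m(2)] unfolding set_integrable_def .
  have [measurable]: "(\<lambda>r. indicator {a..b} r * m r) \<in> borel_measurable borel"
    using m(1) by (simp add: set_borel_measurable_def)
  show "(\<lambda>r. \<bar>indicator {a..b} r * m r\<bar>) \<in> borel_measurable lborel" by simp
  have "\<bar>x\<bar> \<le> 1 + \<bar>x\<bar> powr p" for x :: real
  proof (cases "\<bar>x\<bar> \<le> 1")
    case False
    then have "\<bar>x\<bar> powr 1 \<le> \<bar>x\<bar> powr p" using \<open>1 \<le> p\<close> by (intro powr_mono) auto
    then show ?thesis using False by simp
  qed (simp add: add_increasing2)
  then show "AE r in lborel. norm \<bar>indicator {a..b} r * m r\<bar> \<le> norm (indicator {a..b} r *\<^sub>R (1 + \<bar>m r\<bar> powr p))"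
    by (intro always_eventually) (auto simp: indicator_def abs_mult)
qed

text \<open>A strong upper gradient is tested on curves of class \<open>AC_on 1\<close> in the
  effective domain. On a bounded interval integrability of the power implies that of m, so the
  restricted curve qualifies.\<close>

lemma AC_loc_on_imp_AC_on:
  assumes u: "AC_loc_on p {0..} S d u" and "1 \<le> p" and D: "\<And>t. 0 \<le> t \<Longrightarrow> t \<le> T \<Longrightarrow> u t \<in> D"
  shows "AC_on 1 {0..T} D d u"
proof -
  obtain m where m: "Lp_loc_on p {0..} m" "AC_bound {0..} d u m"
    using u unfolding AC_loc_on_def by auto
  then have mT: "Lp_on p {0..T} m" unfolding Lp_loc_on_def by auto
  then have "integrable lborel (\<lambda>r. \<bar>indicator {0..T} r * m r\<bar>)"
    using set_integrable_abs_of_powr[of 0 T m p] \<open>1 \<le> p\<close> unfolding Lp_on_def by auto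
  then have "Lp_on 1 {0..T} m"
    using mT unfolding Lp_on_def by (auto simp: set_integrable_def abs_mult)
  moreover have "AC_bound {0..T} d u m" using m(2) unfolding AC_bound_def by auto
  ultimately show ?thesis using D unfolding AC_on_def by auto
qed

text \<open>One integrable function serves both for the derivative relative to the half-line, used
  in the energy identity, and for the one relative to [0, T], used when testing a strong upper
  gradient; at interior points the two limits coincide.\<close>

lemma AC_loc_on_metric_derivative:
  assumes S: "Metric_space S d" and u: "AC_loc_on p {0..} S d u" and "1 \<le> p" "0 < T"
  obtains f where "integrable lborel f" "\<And>x. 0 \<le> f x"
    "AE x in lborel. 0 < x \<and> x < T \<longrightarrow> ((\<lambda>s. d (u x) (u s) / \<bar>x - s\<bar>) \<longlongrightarrow> f x) (at x)"
    "AE x in lborel. 0 < x \<and> x < T \<longrightarrow> metric_deriv {0..} d u x = f x"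
    "AE x in lborel. 0 < x \<and> x < T \<longrightarrow> metric_deriv {0..T} d u x = f x"
    "\<And>s t. 0 \<le> s \<Longrightarrow> s \<le> t \<Longrightarrow> t \<le> T \<Longrightarrow> d (u s) (u t) \<le> (LINT r:{s..t}|lborel. f r)"
proof -
  obtain m where m: "Lp_loc_on p {0..} m" "AC_bound {0..} d u m" and uS: "\<And>t. 0 \<le> t \<Longrightarrow> u t \<in> S"
    using u unfolding AC_loc_on_def by auto
  then have "Lp_on p {0..T} m" unfolding Lp_loc_on_def by auto
  define n where "n r = \<bar>indicator {0..T} r * m r\<bar>" for r
  have n: "integrable lborel n" "\<And>x. 0 \<le> n x"
    using set_integrable_abs_of_powr[of 0 T m p] \<open>1 \<le> p\<close> \<open>Lp_on p {0..T} m\<close> unfolding Lp_on_def n_def by auto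
  \<comment> \<open>Clamping time to [0, T] freezes the curve outside and extends it to the whole
    line; there n vanishes and so do the distances.\<close>
  define c where "c t = max 0 (min T t)" for t
  define v where "v t = u (c t)" for t
  have vS: "v t \<in> S" for t using \<open>0 < T\<close> by (auto simp: v_def c_def intro!: uS)
  have d0: "d (v t) (v t) = 0" for t using Metric_space.mdist_zero[OF S vS] .
  have v_bound: "d (v s) (v t) \<le> (LINT r:{s..t}|lborel. n r)" if "s \<le> t" for s t
  proof (cases "c s < c t")
    case True
    then have sub: "{c s..c t} \<subseteq> {s..t} \<inter> {0..T}" and c0: "0 \<le> c s" "0 \<le> c t"
      using that \<open>0 < T\<close> by (auto simp: c_def min_def max_def split: if_splits)
    have "d (v s) (v t) \<le> (LINT r:{c s..c t}|lborel. m r)"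
      using m(2) True c0 unfolding AC_bound_def v_def by auto
    also have "\<dots> \<le> (LINT r:{s..t}|lborel. n r)"
      unfolding set_lebesgue_integral_def
    proof (rule integral_mono')
      show "integrable lborel (\<lambda>r. indicator {s..t} r *\<^sub>R n r)"
        using set_integrable_interval[OF n(1)] unfolding set_integrable_def .
    qed (use sub in \<open>auto simp: indicator_def n_def\<close>)
    finally show ?thesis .
  next
    case False
    then have "c s = c t" using that by (auto simp: c_def)
    then have "d (v s) (v t) = 0" using d0[of t] by (simp add: v_def)
    also have "0 \<le> (LINT r:{s..t}|lborel. n r)"
      unfolding set_lebesgue_integral_def using n(2) by (intro integral_nonneg_AE) auto
    finally show ?thesis .
  qed
  obtain f where f: "integrable lborel f" "\<And>x. 0 \<le> f x"
    "AE x in lborel. ((\<lambda>s. d (v x) (v s) / \<bar>x - s\<bar>) \<longlongrightarrow> f x) (at x)"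
    "\<And>s t. s \<le> t \<Longrightarrow> d (v s) (v t) \<le> (LINT r:{s..t}|lborel. f r)"
    using metric_derivative_exists[OF S vS n v_bound] by blast
  have lim: "AE x in lborel. 0 < x \<and> x < T \<longrightarrow> ((\<lambda>s. d (u x) (u s) / \<bar>x - s\<bar>) \<longlongrightarrow> f x) (at x)"
    using f(3)
  proof eventually_elim
    fix x assume lim: "((\<lambda>s. d (v x) (v s) / \<bar>x - s\<bar>) \<longlongrightarrow> f x) (at x)"
    show "0 < x \<and> x < T \<longrightarrow> ((\<lambda>s. d (u x) (u s) / \<bar>x - s\<bar>) \<longlongrightarrow> f x) (at x)"
    proof
      assume x: "0 < x \<and> x < T"
      show "((\<lambda>s. d (u x) (u s) / \<bar>x - s\<bar>) \<longlongrightarrow> f x) (at x)"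
        using lim
      proof (rule Lim_transform_within_open[of _ _ _ _ "{0<..<T}"])
        show "d (v x) (v s) / \<bar>x - s\<bar> = d (u x) (u s) / \<bar>x - s\<bar>" if "s \<in> {0<..<T}" "s \<noteq> x" for s
          using that x by (simp add: v_def c_def)
      qed (use x in auto)
    qed
  qed
  have md: "metric_deriv I d u x = f x"
    if "((\<lambda>s. d (u x) (u s) / \<bar>x - s\<bar>) \<longlongrightarrow> f x) (at x)" "x \<in> interior I" for x I
    unfolding metric_deriv_def at_within_interior[OF that(2)]
    by (rule tendsto_Lim[OF _ that(1)]) simp
  show thesis
  proof (rule that[OF f(1,2) lim])
    show "AE x in lborel. 0 < x \<and> x < T \<longrightarrow> metric_deriv {0..} d u x = f x"
      using lim by eventually_elim (auto intro!: md)
    show "AE x in lborel. 0 < x \<and> x < T \<longrightarrow> metric_deriv {0..T} d u x = f x"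
      using lim by eventually_elim (auto intro!: md)
    show "d (u s) (u t) \<le> (LINT r:{s..t}|lborel. f r)" if "0 \<le> s" "s \<le> t" "t \<le> T" for s t
      using f(4)[OF \<open>s \<le> t\<close>] that by (simp add: v_def c_def)
  qed
qed

text \<open>Measurability is relative to [a, c] because that is what a strong upper gradient
  provides along a curve; the shared end point b is a null set.\<close>

lemma nn_integral_Icc_combine:
  fixes F :: "real \<Rightarrow> ennreal"
  assumes [measurable]: "F \<in> borel_measurable (restrict_space borel {a..c})" and "a \<le> b" "b \<le> c"
  shows "(\<integral>\<^sup>+r\<in>{a..c}. F r \<partial>lborel) = (\<integral>\<^sup>+r\<in>{a..b}. F r \<partial>lborel) + (\<integral>\<^sup>+r\<in>{b..c}. F r \<partial>lborel)"
proof -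
  have [measurable]: "(\<lambda>r. F r * indicator {a..c} r) \<in> borel_measurable borel"
    using assms(1) by (subst (asm) borel_measurable_restrict_space_iff_ennreal) auto
  have "(\<integral>\<^sup>+r\<in>{a..b}. F r \<partial>lborel) + (\<integral>\<^sup>+r\<in>{b..c}. F r \<partial>lborel) =
    (\<integral>\<^sup>+r\<in>{a..b}. (F r * indicator {a..c} r) \<partial>lborel) + (\<integral>\<^sup>+r\<in>{b..c}. (F r * indicator {a..c} r) \<partial>lborel)"
    using assms(2,3) by (intro arg_cong2[where f="(+)"] nn_integral_cong) (auto simp: indicator_def)
  also have "\<dots> = (\<integral>\<^sup>+r. (F r * indicator {a..c} r) * indicator {a..b} r + (F r * indicator {a..c} r) * indicator {b..c} r \<partial>lborel)"
    by (rule nn_integral_add[symmetric]) measurable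
  also have "\<dots> = (\<integral>\<^sup>+r\<in>{a..c}. F r \<partial>lborel)"
    using AE_lborel_singleton[of b] assms(2,3)
    by (intro nn_integral_cong_AE) (auto elim!: eventually_mono simp: indicator_def)
  finally show ?thesis by simp
qed

section \<open>Lower semicontinuity of the velocity term\<close>

lemma ennreal_liminf_add_le:
  fixes x y :: "nat \<Rightarrow> ennreal"
  shows "liminf x + liminf y \<le> liminf (\<lambda>k. x k + y k)"
proof -
  have "liminf x + liminf y = (SUP n. (INF k\<in>{n..}. x k) + (INF k\<in>{n..}. y k))"
    unfolding liminf_SUP_INF
    by (rule ennreal_SUP_add[symmetric]) (auto simp: incseq_def intro!: INF_superset_mono)
  also have "\<dots> \<le> liminf (\<lambda>k. x k + y k)"
    unfolding liminf_SUP_INF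
    by (intro SUP_mono' INF_greatest add_mono INF_lower) auto
  finally show ?thesis .
qed

text \<open>\<open>A k s t\<close> stands for the velocity integral of the kth curve over [s, t].
  Its additivity becomes superadditivity of the lower limits, so an increment of \<open>V\<close>
  dominates the lower limit over the corresponding interval.\<close>

lemma metric_deriv_liminf_le:
  fixes f :: "real \<Rightarrow> real" and A :: "nat \<Rightarrow> real \<Rightarrow> real \<Rightarrow> ennreal"
  assumes "1 < p" "0 < T"
    and lim: "AE x in lborel. 0 < x \<and> x < T \<longrightarrow> ((\<lambda>s. d (u x) (u s) / \<bar>x - s\<bar>) \<longlongrightarrow> f x) (at x)"
    and f0: "\<And>x. 0 \<le> f x" and d0: "\<And>x y. 0 \<le> d x y"
    and A_add: "\<And>k s t. 0 \<le> s \<Longrightarrow> s \<le> t \<Longrightarrow> t \<le> T \<Longrightarrow> A k 0 t = A k 0 s + A k s t"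
    and A: "\<And>s t. 0 \<le> s \<Longrightarrow> s < t \<Longrightarrow> t \<le> T \<Longrightarrow>
      ennreal (d (u s) (u t) powr p) \<le> ennreal ((t - s) powr (p - 1)) * liminf (\<lambda>k. A k s t)"
  shows "(\<integral>\<^sup>+r\<in>{0..T}. ennreal (f r powr p) \<partial>lborel) \<le> liminf (\<lambda>k. A k 0 T)"
proof (cases "liminf (\<lambda>k. A k 0 T) = \<infinity>")
  case False
  define L where "L t = liminf (\<lambda>k. A k 0 t)" for t
  have L_add: "L s + liminf (\<lambda>k. A k s t) \<le> L t" if "0 \<le> s" "s \<le> t" "t \<le> T" for s t
    unfolding L_def A_add[OF that] by (rule ennreal_liminf_add_le)
  have L_mono: "L s \<le> L t" if "0 \<le> s" "s \<le> t" "t \<le> T" for s t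
    using order_trans[OF _ L_add[OF that]] by simp
  have L_fin: "L t \<noteq> \<infinity>" if "0 \<le> t" "t \<le> T" for t
    using L_mono[of t T] that False by (auto simp: L_def top_unique)
  \<comment> \<open>Clamping t to [0, T] makes \<open>V\<close> monotone on the line and constant
    after T, as the difference quotient lemma demands.\<close>
  define V where "V t = enn2real (L (max 0 (min T t)))" for t
  have VL: "ennreal (V t) = L t" if "0 \<le> t" "t \<le> T" for t
    using L_fin[OF that] that by (simp add: V_def less_top)
  have "mono V"
  proof
    fix s t :: real assume "s \<le> t"
    then have *: "0 \<le> max 0 (min T s)" "max 0 (min T s) \<le> max 0 (min T t)" "max 0 (min T t) \<le> T"
      using \<open>0 < T\<close> by auto
    then have "L (max 0 (min T t)) < top"
      using L_fin[of "max 0 (min T t)"] by (simp add: less_top)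
    then show "V s \<le> V t" unfolding V_def by (rule enn2real_mono[OF L_mono[OF *]])
  qed
  \<comment> \<open>Dividing the distance bound by (t - s)^p leaves the factor 1 / (t - s), which
    turns the increment of \<open>V\<close> into a difference quotient.\<close>
  have key: "ennreal ((d (u s) (u t) / (t - s)) powr p) \<le> ennreal ((V t - V s) / (t - s))"
    if st: "0 \<le> s" "s < t" "t \<le> T" for s t
  proof -
    have le: "ennreal (V s) + liminf (\<lambda>k. A k s t) \<le> ennreal (V t)"
      using L_add[of s t] VL[of s] VL[of t] st by simp
    have V0: "0 \<le> V s" "0 \<le> V t" by (auto simp: V_def)
    have "liminf (\<lambda>k. A k s t) \<le> ennreal (V t - V s)"
    proof (cases "liminf (\<lambda>k. A k s t)")
      case (real x)
      then have "ennreal (V s + x) \<le> ennreal (V t)" using le V0 by simp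
      then have "x \<le> V t - V s" using V0 by (simp add: ennreal_le_iff)
      then show ?thesis unfolding real by (intro ennreal_leI)
    qed (use le in \<open>simp add: top_unique\<close>)
    then have "ennreal (d (u s) (u t) powr p) \<le> ennreal ((t - s) powr (p - 1)) * ennreal (V t - V s)"
      using A[OF st] by (meson mult_left_mono order_trans zero_le)
    then have "d (u s) (u t) powr p \<le> (t - s) powr (p - 1) * (V t - V s)"
      using monoD[OF \<open>mono V\<close>, of s t] st by (simp flip: ennreal_mult')
    then have "(d (u s) (u t) / (t - s)) powr p \<le> (V t - V s) / (t - s)"
      using st d0[of "u s" "u t"] by (simp add: powr_divide powr_diff field_simps)
    then show ?thesis by (rule ennreal_leI)
  qed
  have "(\<integral>\<^sup>+r\<in>{0..T}. ennreal (f r powr p) \<partial>lborel) \<le> ennreal (V T - V 0)"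
  proof (rule nn_integral_liminf_difference_quotient[OF \<open>mono V\<close> _ \<open>0 < T\<close>])
    show "V t = V T" if "T \<le> t" for t using that \<open>0 < T\<close> by (simp add: V_def)
    show "AE r in lborel. 0 < r \<and> r < T \<longrightarrow>
       ennreal (f r powr p) \<le> liminf (\<lambda>n. ennreal ((V (r + 1 / real (Suc n)) - V r) * real (Suc n)))"
      using lim
    proof (eventually_elim, intro impI)
      fix x assume lim: "0 < x \<and> x < T \<longrightarrow> ((\<lambda>s. d (u x) (u s) / \<bar>x - s\<bar>) \<longlongrightarrow> f x) (at x)"
        and x: "0 < x \<and> x < T"
      define h where "h n = 1 / real (Suc n)" for n
      have h: "h \<longlonglongrightarrow> 0" "\<And>n. 0 < h n" unfolding h_def using LIMSEQ_inverse_real_of_nat by (auto simp: inverse_eq_divide)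
      have "filterlim (\<lambda>n. x + h n) (at x) sequentially"
        using h tendsto_add[OF tendsto_const h(1), of x] by (auto simp: filterlim_at less_imp_neq[symmetric] intro!: always_eventually)
      from filterlim_compose[OF lim[rule_format, OF x] this]
      have "(\<lambda>n. d (u x) (u (x + h n)) / h n) \<longlonglongrightarrow> f x"
        using h(2) by (simp add: abs_of_pos)
      then have "(\<lambda>n. (d (u x) (u (x + h n)) / h n) powr p) \<longlonglongrightarrow> f x powr p"
        using \<open>1 < p\<close> d0 h(2) by (intro tendsto_powr') (auto simp: less_imp_le)
      then have "(\<lambda>n. ennreal ((d (u x) (u (x + h n)) / h n) powr p)) \<longlonglongrightarrow> ennreal (f x powr p)"
        by (rule tendsto_ennrealI)
      from lim_imp_Liminf[OF trivial_limit_sequentially this]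
      have "ennreal (f x powr p) = liminf (\<lambda>n. ennreal ((d (u x) (u (x + h n)) / h n) powr p))"
        by (rule sym)
      also have "\<dots> \<le> liminf (\<lambda>n. ennreal ((V (x + h n) - V x) / h n))"
      proof (rule Liminf_mono)
        have "\<forall>\<^sub>F n in sequentially. h n < T - x" using h x by (auto intro: order_tendstoD)
        then show "\<forall>\<^sub>F n in sequentially. ennreal ((d (u x) (u (x + h n)) / h n) powr p) \<le> ennreal ((V (x + h n) - V x) / h n)"
        proof eventually_elim
          fix n assume "h n < T - x"
          then show "ennreal ((d (u x) (u (x + h n)) / h n) powr p) \<le> ennreal ((V (x + h n) - V x) / h n)"
            using key[of x "x + h n"] x h(2)[of n] by simp
        qed
      qed
      finally show "ennreal (f x powr p) \<le> liminf (\<lambda>n. ennreal ((V (x + 1 / real (Suc n)) - V x) * real (Suc n)))"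
        by (simp add: h_def)
    qed
  qed
  also have "\<dots> \<le> ennreal (V T)" by (intro ennreal_leI) (simp add: V_def)
  also have "\<dots> = liminf (\<lambda>k. A k 0 T)" using VL[of T] \<open>0 < T\<close> by (simp add: L_def)
  finally show ?thesis .
qed simp

section \<open>Uniform bounds\<close>

lemma powr_add_le_real:
  fixes x y p :: real
  assumes "0 \<le> x" "0 \<le> y" "0 \<le> p"
  shows "(x + y) powr p \<le> 2 powr p * (x powr p + y powr p)"
proof -
  have "(x + y) powr p \<le> (2 * max x y) powr p" using assms by (intro powr_mono2) auto
  also have "\<dots> = 2 powr p * max x y powr p" using assms by (simp add: powr_mult)
  also have "max x y powr p \<le> x powr p + y powr p" by (auto simp: max_def)
  finally show ?thesis by simp
qed

text \<open>The coercivity bound lets the distance travelled in a time step of fixed length be absorbed,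
  so that a bound on the curves propagates from step to step.\<close>

lemma energy_curves_bounded:
  fixes d :: "'a \<Rightarrow> 'a \<Rightarrow> real" and u :: "nat \<Rightarrow> real \<Rightarrow> 'a" and \<Phi> :: "nat \<Rightarrow> real \<Rightarrow> real"
  assumes S: "Metric_space S d" and uS: "\<And>k t. 0 \<le> t \<Longrightarrow> u k t \<in> S" and w: "w \<in> S"
    and "1 < p" "0 < C"
    and step: "\<And>k s t. 0 \<le> s \<Longrightarrow> s < t \<Longrightarrow>
      d (u k s) (u k t) powr p \<le> (t - s) powr (p - 1) * (p * (\<Phi> k s - \<Phi> k t))"
    and lower: "\<And>k t. 0 \<le> t \<Longrightarrow> B - C * d (u k t) w powr p \<le> \<Phi> k t"
    and upper: "\<And>k t. 0 \<le> t \<Longrightarrow> \<Phi> k t \<le> K"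
    and init: "\<And>k. d (u k 0) w \<le> Y0"
  shows "\<exists>Y. \<forall>k t. 0 \<le> t \<and> t \<le> T \<longrightarrow> d (u k t) w \<le> Y"
proof -
  interpret Metric_space S d by fact
  \<comment> \<open>The step length is chosen so that the coefficient of z^p on the right of the
    energy estimate below becomes 1 / 2 and can be absorbed on the left.\<close>
  define \<tau> where "\<tau> = (1 / (2 * p * C * 2 powr p)) powr (1 / (p - 1))"
  have tau: "0 < \<tau>" "\<tau> powr (p - 1) * p * (C * 2 powr p) = 1 / 2"
    using \<open>1 < p\<close> \<open>0 < C\<close> by (auto simp: \<tau>_def powr_powr)
  have "\<exists>Y. \<forall>k t. 0 \<le> t \<and> t \<le> real n * \<tau> \<longrightarrow> d (u k t) w \<le> Y" for n
  proof (induction n)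
    case 0
    then show ?case using init by (auto intro!: exI[of _ Y0] simp: antisym_conv)
  next
    case (Suc n)
    then obtain Y where Y: "\<And>k t. 0 \<le> t \<Longrightarrow> t \<le> real n * \<tau> \<Longrightarrow> d (u k t) w \<le> Y" by auto
    \<comment> \<open>Twice the remaining constant: z^p is at most that constant plus half of z^p.
      The absolute value makes \<open>R\<close> nonnegative.\<close>
    define R where "R = 2 * \<bar>\<tau> powr (p - 1) * p * (K - B + C * 2 powr p * Y powr p)\<bar>"
    have "d (u k t) w \<le> Y + 1 + R" if t: "0 \<le> t" "t \<le> real (Suc n) * \<tau>" for k t
    proof (cases "t \<le> real n * \<tau>")
      case True
      then show ?thesis using Y[OF t(1) True, of k] by (simp add: R_def)
    next
      case False
      define s where "s = real n * \<tau>"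
      have s: "0 \<le> s" "s < t" "t - s \<le> \<tau>" using False t tau(1) by (auto simp: s_def algebra_simps)
      define z where "z = d (u k s) (u k t)"
      define y where "y = d (u k s) w"
      have y: "0 \<le> y" "y \<le> Y" using Y[OF s(1), of k] by (auto simp: y_def s_def)
      have z: "0 \<le> z" by (simp add: z_def)
      have x: "d (u k t) w \<le> y + z"
        using triangle[of "u k t" "u k s" w] commute[of "u k s" "u k t"] uS[of t k] uS[of s k] w s t
        by (auto simp: y_def z_def)
      have "z powr p \<le> (t - s) powr (p - 1) * (p * (\<Phi> k s - \<Phi> k t))"
        unfolding z_def using step s by simp
      also have "\<dots> \<le> (t - s) powr (p - 1) * (p * (K - B + C * 2 powr p * (Y powr p + z powr p)))"
      proof (intro mult_left_mono)
        have "d (u k t) w powr p \<le> (y + z) powr p" using x \<open>1 < p\<close> by (intro powr_mono2) auto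
        also have "\<dots> \<le> 2 powr p * (y powr p + z powr p)" using y z \<open>1 < p\<close> by (intro powr_add_le_real) auto
        also have "\<dots> \<le> 2 powr p * (Y powr p + z powr p)"
          using y \<open>1 < p\<close> by (intro mult_left_mono add_right_mono powr_mono2) auto
        finally have "C * d (u k t) w powr p \<le> C * (2 powr p * (Y powr p + z powr p))"
          using \<open>0 < C\<close> by (intro mult_left_mono) auto
        then show "\<Phi> k s - \<Phi> k t \<le> K - B + C * 2 powr p * (Y powr p + z powr p)"
          using lower[OF t(1), of k] upper[OF s(1), of k] by (simp add: mult.assoc)
      qed (use \<open>1 < p\<close> in auto)
      finally have 1: "z powr p \<le> (t - s) powr (p - 1) * (p * (K - B + C * 2 powr p * (Y powr p + z powr p)))" .
      \<comment> \<open>The sign of the second factor is needed before t - s may be enlarged to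
        \<tau>; it follows since the product dominates z^p.\<close>
      then have "0 \<le> (t - s) powr (p - 1) * (p * (K - B + C * 2 powr p * (Y powr p + z powr p)))"
        by (rule order_trans[rotated]) simp
      then have "0 \<le> p * (K - B + C * 2 powr p * (Y powr p + z powr p))"
        using s by (simp add: zero_le_mult_iff)
      then have "z powr p \<le> \<tau> powr (p - 1) * (p * (K - B + C * 2 powr p * (Y powr p + z powr p)))"
        using s \<open>1 < p\<close> by (intro order_trans[OF 1] mult_right_mono powr_mono2) auto
      also have "\<dots> = \<tau> powr (p - 1) * p * (K - B + C * 2 powr p * Y powr p) + (\<tau> powr (p - 1) * p * (C * 2 powr p)) * z powr p"
        by (simp add: algebra_simps)
      finally have zR: "z powr p \<le> R" unfolding tau(2) R_def by linarith
      have "z \<le> 1 + R"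
      proof (cases "z \<le> 1")
        case False
        then have "z powr 1 \<le> z powr p" using \<open>1 < p\<close> by (intro powr_mono) auto
        then show ?thesis using zR False by simp
      qed (simp add: R_def)
      then show ?thesis using x y by linarith
    qed
    then show ?case by blast
  qed
  moreover obtain n :: nat where "T / \<tau> < real n" using reals_Archimedean2 by blast
  then have "T \<le> real n * \<tau>" using tau(1) by (simp add: field_simps)
  ultimately show ?thesis by (meson order_trans)
qed

section \<open>Energy of curves of maximal slope\<close>

lemma ennreal_mult_liminf_le:
  fixes x :: "nat \<Rightarrow> ennreal"
  shows "c * liminf x \<le> liminf (\<lambda>k. c * x k)"
  unfolding liminf_SUP_INF SUP_mult_left_ennreal
  by (intro SUP_mono' INF_greatest mult_left_mono INF_lower) auto

lemma ennreal_liminf_cmult: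
  fixes x :: "nat \<Rightarrow> ennreal"
  assumes "0 < c"
  shows "liminf (\<lambda>k. ennreal c * x k) = ennreal c * liminf x"
proof (rule antisym)
  have inv: "ennreal (1 / c) * (ennreal c * y) = y" "ennreal c * (ennreal (1 / c) * y) = y" for y
    using assms by (simp_all flip: mult.assoc ennreal_mult')
  have "ennreal (1 / c) * liminf (\<lambda>k. ennreal c * x k) \<le> liminf x"
    using ennreal_mult_liminf_le[of "ennreal (1 / c)" "\<lambda>k. ennreal c * x k"] by (simp only: inv)
  then show "liminf (\<lambda>k. ennreal c * x k) \<le> ennreal c * liminf x"
    using mult_left_mono[of _ _ "ennreal c"] by (metis inv(2) zero_le)
qed (rule ennreal_mult_liminf_le)

lemma enn2ereal_le_liminf:
  assumes "x \<le> liminf y"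
  shows "enn2ereal x \<le> liminf (\<lambda>k. enn2ereal (y k))"
  unfolding le_Liminf_iff
proof (intro allI impI)
  fix z assume z: "z < enn2ereal x"
  show "\<forall>\<^sub>F k in sequentially. z < enn2ereal (y k)"
  proof (cases "z < 0")
    case True
    then show ?thesis by (intro always_eventually allI) (meson enn2ereal_nonneg less_le_trans)
  next
    case False
    then have "enn2ereal (e2ennreal z) = z" by (intro enn2ereal_e2ennreal) simp
    moreover have "e2ennreal z < x" using z calculation by (metis less_ennreal.rep_eq)
    then have "\<forall>\<^sub>F k in sequentially. e2ennreal z < y k" using assms unfolding le_Liminf_iff by blast
    ultimately show ?thesis by (auto elim!: eventually_mono simp: less_ennreal.rep_eq)
  qed
qed

text \<open>Where the gradient is infinite the right-hand side is infinite too, so the convention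
  for \<infinity> * 0 on the left does no harm.\<close>

lemma ennreal_Youngs_inequality:
  assumes "1 < \<theta>" "1 < \<beta>" "1 / \<theta> + 1 / \<beta> = 1" "0 \<le> y"
  shows "x * ennreal y \<le> ennreal (1 / \<beta>) * ennreal_powr x \<beta> + ennreal (1 / \<theta>) * ennreal (y powr \<theta>)"
proof (cases x)
  case (real r)
  have "r * y \<le> r powr \<beta> / \<beta> + y powr \<theta> / \<theta>"
    using real assms by (intro Youngs_inequality) auto
  then have "ennreal (r * y) \<le> ennreal (1 / \<beta> * r powr \<beta> + 1 / \<theta> * y powr \<theta>)"
    by (intro ennreal_leI) simp
  moreover have "x * ennreal y = ennreal (r * y)"
    using real assms(4) by (simp add: ennreal_mult)
  moreover have "ennreal (1 / \<beta> * r powr \<beta> + 1 / \<theta> * y powr \<theta>) =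
      ennreal (1 / \<beta>) * ennreal (r powr \<beta>) + ennreal (1 / \<theta>) * ennreal (y powr \<theta>)"
    using assms(1,2) by (subst ennreal_plus) (simp_all only: ennreal_mult' zero_le_mult_iff powr_ge_zero zero_le_divide_1_iff, auto)
  ultimately show ?thesis using real by (simp only: ennreal_powr_ennreal)
next
  case top
  have "ennreal (1 / \<beta>) * top = top" using assms(2) by (subst ennreal_mult_top) auto
  then show ?thesis by (simp add: top ennreal_powr_def)
qed

text \<open>The additive form avoids differences of infinities and suits lower limits. Finiteness is
  demanded of the starting energy a only; for b = \<infinity> both sides are false.\<close>

lemma energy_identity_iff:
  fixes a b :: ereal
  assumes "\<bar>a\<bar> \<noteq> \<infinity>" "b \<noteq> - \<infinity>" "0 < x" "0 < y"
  shows "b - a = - (ereal x * enn2ereal G) - ereal y * enn2ereal M \<longleftrightarrow>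
     a = b + enn2ereal (ennreal x * G + ennreal y * M)"
proof -
  obtain a' where a: "a = ereal a'" using assms by (cases a) auto
  have fin: "enn2ereal (ennreal x * ennreal r + ennreal y * ennreal s) = ereal (x * r + y * s)"
    if "0 \<le> r" "0 \<le> s" for r s
  proof -
    have "ennreal x * ennreal r + ennreal y * ennreal s = ennreal (x * r + y * s)"
      using that assms(3,4) by (simp add: ennreal_mult)
    then show ?thesis using that assms(3,4) by (simp only: enn2ereal_ennreal add_nonneg_nonneg mult_nonneg_nonneg less_imp_le)
  qed
  show ?thesis
  proof (cases "G = top \<or> M = top")
    case True
    have "ennreal x * top = top" "ennreal y * top = top"
      using assms(3,4) by (simp_all add: ennreal_mult_top)
    then have "ennreal x * G + ennreal y * M = top" using True by auto
    then have 1: "enn2ereal (ennreal x * G + ennreal y * M) = \<infinity>" by simp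
    have "0 \<le> enn2ereal G" "0 \<le> enn2ereal M" "enn2ereal G = \<infinity> \<or> enn2ereal M = \<infinity>"
      using True by auto
    then have 2: "- (ereal x * enn2ereal G) - ereal y * enn2ereal M = - \<infinity>"
      using assms(3,4) by (cases "enn2ereal G"; cases "enn2ereal M") auto
    show ?thesis unfolding 1 2 using assms(2) a by (cases b) auto
  next
    case False
    then obtain r s where rs: "G = ennreal r" "0 \<le> r" "M = ennreal s" "0 \<le> s"
      by (cases G; cases M) auto
    show ?thesis using assms(2) rs(2,4) unfolding rs(1,3) fin[OF rs(2,4)]
      by (cases b) (auto simp: enn2ereal_ennreal a)
  qed
qed

text \<open>Splitting an integral takes a measurable integrand and Jensen's inequality an integrable
  one; both come from the representative of \<open>metric_deriv\<close>.\<close>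

lemma metric_deriv_powr_integral:
  assumes S: "Metric_space S d" and u: "AC_loc_on p {0..} S d u" and "1 \<le> p" "1 < q"
    and M: "\<And>s t. M s t = (\<integral>\<^sup>+r\<in>{s..t}. ennreal (metric_deriv {0..} d u r powr q) \<partial>lborel)"
  shows "0 \<le> s \<Longrightarrow> s \<le> t \<Longrightarrow> M 0 t = M 0 s + M s t"
    and "0 \<le> s \<Longrightarrow> s < t \<Longrightarrow>
      ennreal (d (u s) (u t) powr q) \<le> ennreal ((t - s) powr (q - 1)) * M s t"
proof -
  \<comment> \<open>The representative depends on the right end t, so t stays fixed and only
    subintervals of [0, t] are compared.\<close>
  have *: "\<exists>f. integrable lborel f \<and> (\<forall>x. 0 \<le> f x) \<and>
     (\<forall>a b. 0 \<le> a \<longrightarrow> b \<le> t \<longrightarrow> M a b = (\<integral>\<^sup>+r\<in>{a..b}. ennreal (f r powr q) \<partial>lborel)) \<and>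
     (\<forall>s. 0 \<le> s \<and> s \<le> t \<longrightarrow> d (u s) (u t) \<le> (LINT r:{s..t}|lborel. f r))" if "0 < t" for t
  proof -
    obtain f where f: "integrable lborel f" "\<And>x. 0 \<le> f x"
      "AE x in lborel. 0 < x \<and> x < t \<longrightarrow> ((\<lambda>s. d (u x) (u s) / \<bar>x - s\<bar>) \<longlongrightarrow> f x) (at x)"
      "AE x in lborel. 0 < x \<and> x < t \<longrightarrow> metric_deriv {0..} d u x = f x"
      "AE x in lborel. 0 < x \<and> x < t \<longrightarrow> metric_deriv {0..t} d u x = f x"
      "\<And>s r. 0 \<le> s \<Longrightarrow> s \<le> r \<Longrightarrow> r \<le> t \<Longrightarrow> d (u s) (u r) \<le> (LINT r:{s..r}|lborel. f r)"
      by (rule AC_loc_on_metric_derivative[OF S u \<open>1 \<le> p\<close> \<open>0 < t\<close>]) (rule that, assumption+)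
    have "M a b = (\<integral>\<^sup>+r\<in>{a..b}. ennreal (f r powr q) \<partial>lborel)" if "0 \<le> a" "b \<le> t" for a b
      unfolding M
    proof (rule nn_integral_cong_AE)
      show "AE r in lborel. ennreal (metric_deriv {0..} d u r powr q) * indicator {a..b} r =
         ennreal (f r powr q) * indicator {a..b} r"
        using f(4) AE_lborel_singleton[of 0] AE_lborel_singleton[of t]
        by eventually_elim (use that in \<open>auto simp: indicator_def\<close>)
    qed
    moreover have "d (u s) (u t) \<le> (LINT r:{s..t}|lborel. f r)" if "0 \<le> s \<and> s \<le> t" for s
      using f(6)[of s t] that by simp
    ultimately show ?thesis using f(1,2) by (intro exI[of _ f]) simp
  qed
  show "M 0 t = M 0 s + M s t" if st: "0 \<le> s" "s \<le> t"
  proof (cases "t = 0")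
    case True
    then have "s = 0" using st by simp
    have "M 0 0 = (\<integral>\<^sup>+r. 0 \<partial>(lborel :: real measure))"
      unfolding M using AE_lborel_singleton[of 0]
      by (intro nn_integral_cong_AE) (auto elim!: eventually_mono)
    then show ?thesis using True \<open>s = 0\<close> by simp
  next
    case False
    then obtain f where f: "integrable lborel f"
      "\<And>a b. 0 \<le> a \<Longrightarrow> b \<le> t \<Longrightarrow> M a b = (\<integral>\<^sup>+r\<in>{a..b}. ennreal (f r powr q) \<partial>lborel)"
      using *[of t] st by auto
    have [measurable]: "f \<in> borel_measurable borel" using f by auto
    show ?thesis using st
      by (simp add: f(2), intro nn_integral_Icc_combine measurable_restrict_space1) auto
  qed
  show "ennreal (d (u s) (u t) powr q) \<le> ennreal ((t - s) powr (q - 1)) * M s t" if st: "0 \<le> s" "s < t"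
  proof -
    obtain f where f: "integrable lborel f" "\<And>x. 0 \<le> f x"
      "\<And>a b. 0 \<le> a \<Longrightarrow> b \<le> t \<Longrightarrow> M a b = (\<integral>\<^sup>+r\<in>{a..b}. ennreal (f r powr q) \<partial>lborel)"
      "\<And>s. 0 \<le> s \<Longrightarrow> s \<le> t \<Longrightarrow> d (u s) (u t) \<le> (LINT r:{s..t}|lborel. f r)"
      using *[of t] st by auto
    have "ennreal (d (u s) (u t) powr q) \<le> ennreal ((LINT r:{s..t}|lborel. f r) powr q)"
      using f(4)[of s] st \<open>1 < q\<close> Metric_space.nonneg[OF S] by (intro ennreal_leI powr_mono2) auto
    also have "\<dots> \<le> ennreal ((t - s) powr (q - 1)) * M s t"
      unfolding f(3)[OF st(1) order_refl] by (rule powr_integral_le[OF f(1,2) st(2) \<open>1 < q\<close>])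
    finally show ?thesis .
  qed
qed

text \<open>The identity started at time 0 makes the energy finite along the curve. The curve is
  then an admissible test curve for its own gradient, and this is where measurability of the slope
  term comes from.\<close>

lemma curve_of_maximal_slope_energy:
  assumes S: "Metric_space S d" and u: "curve_of_maximal_slope \<theta> \<beta> S d \<phi> g w0 u"
    and theta: "1 < \<theta>" and beta: "1 < \<beta>"
    and phi: "\<And>x. x \<in> S \<Longrightarrow> \<phi> x \<noteq> -\<infinity>"
    and E: "\<And>s t. E s t = ennreal (1 / \<beta>) * (\<integral>\<^sup>+r\<in>{s..t}. ennreal_powr (g (u r)) \<beta> \<partial>lborel)
      + ennreal (1 / \<theta>) * (\<integral>\<^sup>+r\<in>{s..t}. ennreal (metric_deriv {0..} d u r powr \<theta>) \<partial>lborel)"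
  shows "0 \<le> t \<Longrightarrow> u t \<in> eff_dom S \<phi>"
    and "0 \<le> s \<Longrightarrow> s < t \<Longrightarrow> \<phi> (u s) = \<phi> (u t) + enn2ereal (E s t)"
    and "(\<lambda>r. ennreal_powr (g (u r)) \<beta>) \<in> borel_measurable (restrict_space borel {0..T})"
proof -
  have sug: "strong_upper_gradient S d \<phi> g" and w0: "w0 \<in> eff_dom S \<phi>" and ac: "AC_loc_on \<theta> {0..} S d u"
    and u0: "u 0 = w0" and en: "\<And>s t. 0 \<le> s \<Longrightarrow> s < t \<Longrightarrow> \<phi> (u t) - \<phi> (u s) =
          - (ereal (1 / \<beta>) * enn2ereal (\<integral>\<^sup>+r\<in>{s..t}. ennreal_powr (g (u r)) \<beta> \<partial>lborel))
          - ereal (1 / \<theta>) * enn2ereal (\<integral>\<^sup>+r\<in>{s..t}. ennreal (metric_deriv {0..} d u r powr \<theta>) \<partial>lborel)"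
    using u unfolding curve_of_maximal_slope_def by auto
  have uS: "u t \<in> S" if "0 \<le> t" for t using ac that unfolding AC_loc_on_def by auto
  have id: "\<phi> (u s) = \<phi> (u t) + enn2ereal (E s t)" if "0 \<le> s" "s < t" "\<phi> (u s) < \<infinity>" for s t
    using en[OF that(1,2)] phi[OF uS[of s]] phi[OF uS[of t]] that theta beta
    unfolding E by (subst (asm) energy_identity_iff) auto
  have dom: "u t \<in> eff_dom S \<phi>" if "0 \<le> t" for t
  proof (cases "t = 0")
    case True
    then show ?thesis using u0 w0 by simp
  next
    case False
    have fin: "\<phi> (u 0) < \<infinity>" using w0 unfolding u0 eff_dom_def by simp
    have "\<phi> (u 0) = \<phi> (u t) + enn2ereal (E 0 t)" using False that fin by (intro id) auto
    then have "\<phi> (u t) < \<infinity>" using fin by (cases "\<phi> (u t)") auto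
    then show ?thesis using uS[OF that] by (simp add: eff_dom_def)
  qed
  show "0 \<le> t \<Longrightarrow> u t \<in> eff_dom S \<phi>" by (rule dom)
  show "0 \<le> s \<Longrightarrow> s < t \<Longrightarrow> \<phi> (u s) = \<phi> (u t) + enn2ereal (E s t)"
    using dom[of s] by (intro id) (auto simp: eff_dom_def)
  have "AC_on 1 {0..T} (eff_dom S \<phi>) d u"
    using theta dom by (intro AC_loc_on_imp_AC_on[OF ac]) auto
  then have "(\<lambda>r. g (u r)) \<in> borel_measurable (restrict_space borel {0..T})"
    using sug is_interval_cc unfolding strong_upper_gradient_def by blast
  then show "(\<lambda>r. ennreal_powr (g (u r)) \<beta>) \<in> borel_measurable (restrict_space borel {0..T})"
    by (rule measurable_ennreal_powr)
qed

text \<open>Young's inequality under the integral of the upper gradient estimate on [0, t]. The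
  absolute value and the additivity of \<open>E\<close> are what the final comparison on
  subintervals uses.\<close>

lemma strong_upper_gradient_energy_le:
  assumes S: "Metric_space S d" and g: "strong_upper_gradient S d \<phi> g" and ac: "AC_loc_on \<theta> {0..} S d u"
    and theta: "1 < \<theta>" and beta: "1 < \<beta>" and conj: "1 / \<theta> + 1 / \<beta> = 1"
    and dom: "\<And>t. 0 \<le> t \<Longrightarrow> u t \<in> eff_dom S \<phi>"
    and E: "\<And>s t. E s t = ennreal (1 / \<beta>) * (\<integral>\<^sup>+r\<in>{s..t}. ennreal_powr (g (u r)) \<beta> \<partial>lborel)
      + ennreal (1 / \<theta>) * (\<integral>\<^sup>+r\<in>{s..t}. ennreal (metric_deriv {0..} d u r powr \<theta>) \<partial>lborel)"
  shows "0 \<le> s \<Longrightarrow> s < t \<Longrightarrow> \<bar>\<phi> (u t) - \<phi> (u s)\<bar> \<le> enn2ereal (E s t)"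
    and "0 \<le> s \<Longrightarrow> s \<le> t \<Longrightarrow> E 0 t = E 0 s + E s t"
proof -
  have AC: "AC_on 1 {0..t} (eff_dom S \<phi>) d u" for t
    using theta dom by (intro AC_loc_on_imp_AC_on[OF ac]) auto
  have meas: "(\<lambda>r. g (u r)) \<in> borel_measurable (restrict_space borel {0..t})" for t
    using g AC[of t] is_interval_cc unfolding strong_upper_gradient_def by blast
  show "\<bar>\<phi> (u t) - \<phi> (u s)\<bar> \<le> enn2ereal (E s t)" if st: "0 \<le> s" "s < t"
  proof -
    have "0 < t" "1 \<le> \<theta>" using st theta by auto
    obtain f where f: "integrable lborel f" "\<And>x. 0 \<le> f x"
      "AE x in lborel. 0 < x \<and> x < t \<longrightarrow> ((\<lambda>s. d (u x) (u s) / \<bar>x - s\<bar>) \<longlongrightarrow> f x) (at x)"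
      "AE x in lborel. 0 < x \<and> x < t \<longrightarrow> metric_deriv {0..} d u x = f x"
      "AE x in lborel. 0 < x \<and> x < t \<longrightarrow> metric_deriv {0..t} d u x = f x"
      "\<And>s r. 0 \<le> s \<Longrightarrow> s \<le> r \<Longrightarrow> r \<le> t \<Longrightarrow> d (u s) (u r) \<le> (LINT r:{s..r}|lborel. f r)"
      by (rule AC_loc_on_metric_derivative[OF S ac \<open>1 \<le> \<theta>\<close> \<open>0 < t\<close>]) (rule that, assumption+)
    have [measurable]: "f \<in> borel_measurable borel" using f by auto
    have [measurable]: "(\<lambda>r. ennreal_powr (g (u r)) \<beta> * indicator {s..t} r) \<in> borel_measurable borel"
    proof -
      have "(\<lambda>r. ennreal_powr (g (u r)) \<beta>) \<in> borel_measurable (restrict_space borel {s..t})"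
        using measurable_restrict_mono[OF measurable_ennreal_powr[OF meas[of t]], of "{s..t}"] st by simp
      then show ?thesis by (subst (asm) borel_measurable_restrict_space_iff_ennreal) auto
    qed
    have "\<bar>\<phi> (u t) - \<phi> (u s)\<bar> \<le> enn2ereal (\<integral>\<^sup>+r\<in>{s..t}. g (u r) * ennreal (metric_deriv {0..t} d u r) \<partial>lborel)"
      using g AC[of t] is_interval_cc[of 0 t] st unfolding strong_upper_gradient_def by auto
    also have "(\<integral>\<^sup>+r\<in>{s..t}. g (u r) * ennreal (metric_deriv {0..t} d u r) \<partial>lborel) \<le>
      (\<integral>\<^sup>+r. ennreal (1 / \<beta>) * (ennreal_powr (g (u r)) \<beta> * indicator {s..t} r) +
         ennreal (1 / \<theta>) * (ennreal (f r powr \<theta>) * indicator {s..t} r) \<partial>lborel)"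
    proof (rule nn_integral_mono_AE)
      show "AE r in lborel. g (u r) * ennreal (metric_deriv {0..t} d u r) * indicator {s..t} r \<le>
         ennreal (1 / \<beta>) * (ennreal_powr (g (u r)) \<beta> * indicator {s..t} r) +
         ennreal (1 / \<theta>) * (ennreal (f r powr \<theta>) * indicator {s..t} r)"
        using f(5) AE_lborel_singleton[of 0] AE_lborel_singleton[of t]
      proof eventually_elim
        fix r assume "0 < r \<and> r < t \<longrightarrow> metric_deriv {0..t} d u r = f r" "r \<noteq> 0" "r \<noteq> t"
        then have "metric_deriv {0..t} d u r = f r" if "r \<in> {s..t}" using that st by auto
        moreover have "g (u r) * ennreal (f r) \<le>
            ennreal (1 / \<beta>) * ennreal_powr (g (u r)) \<beta> + ennreal (1 / \<theta>) * ennreal (f r powr \<theta>)"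
          by (rule ennreal_Youngs_inequality[OF theta beta conj f(2)])
        ultimately show "g (u r) * ennreal (metric_deriv {0..t} d u r) * indicator {s..t} r \<le>
         ennreal (1 / \<beta>) * (ennreal_powr (g (u r)) \<beta> * indicator {s..t} r) +
         ennreal (1 / \<theta>) * (ennreal (f r powr \<theta>) * indicator {s..t} r)"
          unfolding indicator_def by (cases "r \<in> {s..t}") auto
      qed
    qed
    also have "\<dots> = ennreal (1 / \<beta>) * (\<integral>\<^sup>+r\<in>{s..t}. ennreal_powr (g (u r)) \<beta> \<partial>lborel)
         + ennreal (1 / \<theta>) * (\<integral>\<^sup>+r\<in>{s..t}. ennreal (f r powr \<theta>) \<partial>lborel)"
      by (subst nn_integral_add, measurable) (subst nn_integral_cmult, measurable)+
    also have "(\<integral>\<^sup>+r\<in>{s..t}. ennreal (f r powr \<theta>) \<partial>lborel) =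
      (\<integral>\<^sup>+r\<in>{s..t}. ennreal (metric_deriv {0..} d u r powr \<theta>) \<partial>lborel)"
    proof (rule nn_integral_cong_AE)
      show "AE r in lborel. ennreal (f r powr \<theta>) * indicator {s..t} r =
         ennreal (metric_deriv {0..} d u r powr \<theta>) * indicator {s..t} r"
        using f(4) AE_lborel_singleton[of 0] AE_lborel_singleton[of t]
        by eventually_elim (use st in \<open>auto simp: indicator_def\<close>)
    qed
    finally show ?thesis unfolding E by (simp add: less_eq_ennreal.rep_eq)
  qed
  show "E 0 t = E 0 s + E s t" if st: "0 \<le> s" "s \<le> t"
  proof -
    have 1: "(\<integral>\<^sup>+r\<in>{0..t}. ennreal (metric_deriv {0..} d u r powr \<theta>) \<partial>lborel) =
      (\<integral>\<^sup>+r\<in>{0..s}. ennreal (metric_deriv {0..} d u r powr \<theta>) \<partial>lborel) +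
      (\<integral>\<^sup>+r\<in>{s..t}. ennreal (metric_deriv {0..} d u r powr \<theta>) \<partial>lborel)"
      by (rule metric_deriv_powr_integral(1)[OF S ac _ theta refl st]) (use theta in simp)
    have 2: "(\<integral>\<^sup>+r\<in>{0..t}. ennreal_powr (g (u r)) \<beta> \<partial>lborel) =
      (\<integral>\<^sup>+r\<in>{0..s}. ennreal_powr (g (u r)) \<beta> \<partial>lborel) + (\<integral>\<^sup>+r\<in>{s..t}. ennreal_powr (g (u r)) \<beta> \<partial>lborel)"
      by (rule nn_integral_Icc_combine[OF measurable_ennreal_powr[OF meas] st])
    show ?thesis unfolding E 1 2 by (simp add: distrib_left ac_simps)
  qed
qed

section \<open>Passage to the limit in the energy identity\<close>

theorem lemma2p3:
  fixes \<theta> \<beta> :: real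
    and S0 :: "'a set" and d0 :: "'a \<Rightarrow> 'a \<Rightarrow> real" and \<sigma> :: "'a topology"
    and S :: "real \<Rightarrow> 'a set" and d :: "real \<Rightarrow> 'a \<Rightarrow> 'a \<Rightarrow> real"
    and \<phi> :: "'a \<Rightarrow> ereal"
    and g :: "'a \<Rightarrow> ennreal" and g\<^sub>\<epsilon> :: "real \<Rightarrow> 'a \<Rightarrow> ennreal"
    and u0 :: 'a and u0\<^sub>\<epsilon> :: "real \<Rightarrow> 'a"
    and u\<^sub>\<epsilon> :: "real \<Rightarrow> real \<Rightarrow> 'a" and ustar :: "real \<Rightarrow> 'a"
    and \<epsilon> :: "nat \<Rightarrow> real"
  assumes theta: "1 < \<theta>" and beta: "1 / \<theta> + 1 / \<beta> = 1"
    and S0_metric: "Metric_space S0 d0" and S0_complete: "Metric_space.mcomplete S0 d0"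
    and sigma_space: "topspace \<sigma> = S0"
    and sigma_Hausdorff: "Hausdorff_space \<sigma>"
    and sigma_weaker: "\<And>U. openin \<sigma> U \<Longrightarrow> openin (Metric_space.mtopology S0 d0) U"
    and sigma_lsc: "\<And>us vs u v. \<lbrakk>\<And>k. us k \<in> S0; \<And>k. vs k \<in> S0;
         limitin \<sigma> us u sequentially; limitin \<sigma> vs v sequentially\<rbrakk>
         \<Longrightarrow> ereal (d0 u v) \<le> liminf (\<lambda>k. ereal (d0 (us k) (vs k)))"
    and S_metric: "\<And>e. 0 < e \<Longrightarrow> Metric_space (S e) (d e)"
    and S_subset: "\<And>e. 0 < e \<Longrightarrow> S e \<subseteq> S0"
    and d_ge: "\<And>e u v. \<lbrakk>0 < e; u \<in> S e; v \<in> S e\<rbrakk> \<Longrightarrow> d0 u v \<le> d e u v"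
    and phi_not_MInf: "\<And>u. u \<in> S0 \<Longrightarrow> \<phi> u \<noteq> -\<infinity>"
    and phi_proper: "eff_dom S0 \<phi> \<noteq> {}"
    and Phi1: "\<And>us u. \<lbrakk>\<And>k. us k \<in> S0; limitin \<sigma> us u sequentially;
         bdd_above (range (\<lambda>(k, l). d0 (us k) (us l)))\<rbrakk>
         \<Longrightarrow> \<phi> u \<le> liminf (\<lambda>k. \<phi> (us k))"
    and Phi2: "\<exists>w\<in>S0. \<exists>B C. 0 < C \<and> (\<forall>u\<in>S0. ereal (B - C * d0 u w powr \<theta>) \<le> \<phi> u)"
    and Phi3: "\<And>us. \<lbrakk>\<And>k. us k \<in> S0; (SUP k. \<phi> (us k)) < \<infinity>;
         bdd_above (range (\<lambda>(k, l). d0 (us k) (us l)))\<rbrakk>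
         \<Longrightarrow> \<exists>r u. strict_mono (r :: nat \<Rightarrow> nat) \<and> u \<in> S0 \<and> limitin \<sigma> (us \<circ> r) u sequentially"
    and u0: "u0 \<in> eff_dom S0 \<phi>"
    and u0e_in: "\<And>e. 0 < e \<Longrightarrow> u0\<^sub>\<epsilon> e \<in> S e"
    and u0e_bdd: "bdd_above ((\<lambda>e. d0 (u0\<^sub>\<epsilon> e) u0) ` {0<..})"
    and u0e_lim: "limitin \<sigma> u0\<^sub>\<epsilon> u0 (at_right 0)"
    and phi_u0e_lim: "((\<lambda>e. \<phi> (u0\<^sub>\<epsilon> e)) \<longlongrightarrow> \<phi> u0) (at_right 0)"
    and ge_sug: "\<And>e. 0 < e \<Longrightarrow> strong_upper_gradient (S e) (d e) \<phi> (g\<^sub>\<epsilon> e)"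
    and ue_curve: "\<And>e. 0 < e \<Longrightarrow>
         curve_of_maximal_slope \<theta> \<beta> (S e) (d e) \<phi> (g\<^sub>\<epsilon> e) (u0\<^sub>\<epsilon> e) (u\<^sub>\<epsilon> e)"
    and g_sug: "strong_upper_gradient S0 d0 \<phi> g"
    and g_liminf: "\<And>e us u. \<lbrakk>\<And>k. 0 < e k; e \<longlonglongrightarrow> 0; \<And>k. us k \<in> S (e k); u \<in> S0;
         limitin \<sigma> us u sequentially\<rbrakk>
         \<Longrightarrow> g u \<le> liminf (\<lambda>k. g\<^sub>\<epsilon> (e k) (us k))"
    and eps_pos: "\<And>k. 0 < \<epsilon> k" and eps_lim: "\<epsilon> \<longlonglongrightarrow> 0"
    and ustar_AC: "AC_loc_on \<theta> {0..} S0 d0 ustar"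
    and ustar_0: "ustar 0 = u0"
    and ustar_lim: "\<And>t. 0 \<le> t \<Longrightarrow> limitin \<sigma> (\<lambda>k. u\<^sub>\<epsilon> (\<epsilon> k) t) (ustar t) sequentially"
  shows "curve_of_maximal_slope \<theta> \<beta> S0 d0 \<phi> g u0 ustar"
proof -
  interpret S0: Metric_space S0 d0 by fact
  have beta1: "1 < \<beta>" "0 < 1 / \<beta>" "0 < 1 / \<theta>"
  proof -
    have "0 < 1 / \<theta>" "1 / \<theta> < 1" using theta by simp_all
    then have *: "0 < 1 / \<beta>" "1 / \<beta> < 1" using beta by linarith+
    then have "0 < \<beta>" by (simp add: zero_less_divide_1_iff)
    with * show "1 < \<beta>" "0 < 1 / \<beta>" by (simp_all add: divide_less_eq)
    show "0 < 1 / \<theta>" by fact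
  qed
  define u where "u k = u\<^sub>\<epsilon> (\<epsilon> k)" for k
  have S_phi: "\<phi> x \<noteq> - \<infinity>" if "x \<in> S (\<epsilon> k)" for k x
    using that phi_not_MInf S_subset[OF eps_pos[of k]] by auto
  define G where "G k s t = (\<integral>\<^sup>+r\<in>{s..t}. ennreal_powr (g\<^sub>\<epsilon> (\<epsilon> k) (u k r)) \<beta> \<partial>lborel)" for k s t
  define M where "M k s t = (\<integral>\<^sup>+r\<in>{s..t}. ennreal (metric_deriv {0..} (d (\<epsilon> k)) (u k) r powr \<theta>) \<partial>lborel)" for k s t
  define E where "E k s t = ennreal (1 / \<beta>) * G k s t + ennreal (1 / \<theta>) * M k s t" for k s t
  have curve: "curve_of_maximal_slope \<theta> \<beta> (S (\<epsilon> k)) (d (\<epsilon> k)) \<phi> (g\<^sub>\<epsilon> (\<epsilon> k)) (u0\<^sub>\<epsilon> (\<epsilon> k)) (u k)" for k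
    unfolding u_def by (rule ue_curve[OF eps_pos])
  note energy = curve_of_maximal_slope_energy[OF S_metric[OF eps_pos] curve theta beta1(1) S_phi E_def[unfolded G_def M_def]]
  have u_init: "u k 0 = u0\<^sub>\<epsilon> (\<epsilon> k)" and u_ac: "AC_loc_on \<theta> {0..} (S (\<epsilon> k)) (d (\<epsilon> k)) (u k)" for k
    using curve[of k] unfolding curve_of_maximal_slope_def by auto
  have u_dom: "u k t \<in> eff_dom (S (\<epsilon> k)) \<phi>" if "0 \<le> t" for k t
    by (rule energy(1)[OF _ that])
  then have uS: "u k t \<in> S (\<epsilon> k)" "u k t \<in> S0" and u_fin: "\<phi> (u k t) < \<infinity>" if "0 \<le> t" for k t
    using that S_subset[OF eps_pos[of k]] by (auto simp: eff_dom_def)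
  have u_energy: "\<phi> (u k s) = \<phi> (u k t) + enn2ereal (E k s t)" if "0 \<le> s" "s < t" for k s t
    by (rule energy(2)[OF _ that])
  have g_meas: "(\<lambda>r. ennreal_powr (g\<^sub>\<epsilon> (\<epsilon> k) (u k r)) \<beta>) \<in> borel_measurable (restrict_space borel {0..t})" for k t
    by (rule energy(3))
  have th1: "1 \<le> \<theta>" using theta by simp
  note M_add = metric_deriv_powr_integral(1)[OF S_metric[OF eps_pos] u_ac th1 theta M_def]
    and M_dist = metric_deriv_powr_integral(2)[OF S_metric[OF eps_pos] u_ac th1 theta M_def]
  have u_lim: "limitin \<sigma> (\<lambda>k. u k t) (ustar t) sequentially" if "0 \<le> t" for t
    unfolding u_def by (rule ustar_lim[OF that])
  have ustar_S: "ustar t \<in> S0" if "0 \<le> t" for t using ustar_AC that unfolding AC_loc_on_def by auto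

  \<comment> \<open>Every curve moves in a metric of its own; \<open>d_ge\<close> brings the
    estimate to \<open>d0\<close>, the metric in which the limit curve is measured.\<close>
  have d0_le: "ennreal (d0 (u k s) (u k t) powr \<theta>) \<le> ennreal ((t - s) powr (\<theta> - 1)) * M k s t"
    if "0 \<le> s" "s < t" for k s t
  proof -
    have "d0 (u k s) (u k t) \<le> d (\<epsilon> k) (u k s) (u k t)"
      using that by (intro d_ge[OF eps_pos] uS) auto
    then have "ennreal (d0 (u k s) (u k t) powr \<theta>) \<le> ennreal (d (\<epsilon> k) (u k s) (u k t) powr \<theta>)"
      using theta by (intro ennreal_leI powr_mono2) auto
    also have "\<dots> \<le> ennreal ((t - s) powr (\<theta> - 1)) * M k s t" by (rule M_dist[OF that])
    finally show ?thesis .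
  qed

  define \<Phi> where "\<Phi> k t = real_of_ereal (\<phi> (u k t))" for k t
  have Phi: "\<phi> (u k t) = ereal (\<Phi> k t)" if "0 \<le> t" for k t
    using u_fin[OF that, of k] phi_not_MInf[OF uS(2)[OF that, of k]] unfolding \<Phi>_def
    by (cases "\<phi> (u k t)") auto
  have E_Phi: "E k s t = ennreal (\<Phi> k s - \<Phi> k t)" "\<Phi> k t \<le> \<Phi> k s" if "0 \<le> s" "s < t" for k s t
  proof -
    have *: "ereal (\<Phi> k s) = ereal (\<Phi> k t) + enn2ereal (E k s t)"
      using u_energy[OF that, of k] Phi[of s k] Phi[of t k] that by simp
    then obtain r where "E k s t = ennreal r" "0 \<le> r" by (cases "E k s t") auto
    with * show "E k s t = ennreal (\<Phi> k s - \<Phi> k t)" "\<Phi> k t \<le> \<Phi> k s"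
      by (auto simp: enn2ereal_ennreal)
  qed
  \<comment> \<open>Discarding the slope term of the dissipation leaves the velocity integral
    divided by \<theta>; clearing the denominator gives the factor \<theta>.\<close>
  have step: "d0 (u k s) (u k t) powr \<theta> \<le> (t - s) powr (\<theta> - 1) * (\<theta> * (\<Phi> k s - \<Phi> k t))"
    if "0 \<le> s" "s < t" for k s t
  proof -
    have "ennreal (1 / \<theta>) * M k s t \<le> ennreal (\<Phi> k s - \<Phi> k t)"
      unfolding E_Phi(1)[OF that, symmetric] E_def by simp
    then have "ennreal \<theta> * (ennreal (1 / \<theta>) * M k s t) \<le> ennreal \<theta> * ennreal (\<Phi> k s - \<Phi> k t)"
      by (rule mult_left_mono) simp
    also have "ennreal \<theta> * (ennreal (1 / \<theta>) * M k s t) = M k s t"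
      using theta by (simp flip: mult.assoc ennreal_mult')
    also have "ennreal \<theta> * ennreal (\<Phi> k s - \<Phi> k t) = ennreal (\<theta> * (\<Phi> k s - \<Phi> k t))"
      using theta by (simp add: ennreal_mult')
    finally have "ennreal ((t - s) powr (\<theta> - 1)) * M k s t \<le>
        ennreal ((t - s) powr (\<theta> - 1)) * ennreal (\<theta> * (\<Phi> k s - \<Phi> k t))"
      by (rule mult_left_mono) simp
    with d0_le[OF that, of k]
    have "ennreal (d0 (u k s) (u k t) powr \<theta>) \<le> ennreal ((t - s) powr (\<theta> - 1) * (\<theta> * (\<Phi> k s - \<Phi> k t)))"
      by (simp add: ennreal_mult')
    then show ?thesis using E_Phi(2)[OF that, of k] theta by (simp add: ennreal_le_iff)
  qed

  have phi_u0: "\<bar>\<phi> u0\<bar> \<noteq> \<infinity>" using u0 phi_not_MInf[of u0] by (auto simp: eff_dom_def)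
  have eps_right: "filterlim \<epsilon> (at_right 0) sequentially"
    using eps_lim eps_pos by (auto simp: filterlim_at intro!: always_eventually) (metis less_irrefl)
  have phi_lim: "(\<lambda>k. \<phi> (u k 0)) \<longlonglongrightarrow> \<phi> u0"
    unfolding u_init by (rule filterlim_compose[OF phi_u0e_lim eps_right])
  have "\<exists>K. \<forall>k. \<Phi> k 0 \<le> K"
  proof -
    obtain a where a: "\<phi> u0 = ereal a" using phi_u0 by (cases "\<phi> u0") auto
    have "(\<lambda>k. ereal (\<Phi> k 0)) \<longlonglongrightarrow> ereal a" using phi_lim Phi a by simp
    then have "(\<lambda>k. \<Phi> k 0) \<longlonglongrightarrow> a" by simp
    then have "Bseq (\<lambda>k. \<Phi> k 0)" by (intro convergent_imp_Bseq convergentI)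
    then obtain K where "\<And>k. norm (\<Phi> k 0) \<le> K" unfolding Bseq_def by auto
    then show ?thesis by (intro exI[of _ K]) (metis abs_le_D1 real_norm_def)
  qed
  then obtain K where K: "\<And>k. \<Phi> k 0 \<le> K" by auto
  obtain w B C where w: "w \<in> S0" "0 < C" "\<And>x. x \<in> S0 \<Longrightarrow> ereal (B - C * d0 x w powr \<theta>) \<le> \<phi> x"
    using Phi2 by auto
  obtain Y where Y: "\<And>k. d0 (u k 0) u0 \<le> Y"
    using u0e_bdd eps_pos unfolding bdd_above_def u_init by fastforce
  have u0_S: "u0 \<in> S0" using u0 by (simp add: eff_dom_def)
  \<comment> \<open>\<open>K\<close> bounds the initial energies and, since energy decreases in
    time, all later ones; \<open>Y + d0 u0 w\<close> bounds the initial distances to the centre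
    \<open>w\<close> of the coercivity bound.\<close>
  have bounded: "\<exists>Y. \<forall>k t. 0 \<le> t \<and> t \<le> T \<longrightarrow> d0 (u k t) w \<le> Y" for T
  proof (rule energy_curves_bounded[OF S0_metric uS(2) w(1) theta w(2) step])
    show "B - C * d0 (u k t) w powr \<theta> \<le> \<Phi> k t" if "0 \<le> t" for k t
      using w(3)[OF uS(2)[OF that, of k]] Phi[OF that, of k] by simp
    show "\<Phi> k t \<le> K" if "0 \<le> t" for k t
      using K[of k] E_Phi(2)[of 0 t k] that by (cases "t = 0") auto
    show "d0 (u k 0) w \<le> Y + d0 u0 w" for k
      using S0.triangle[OF uS(2)[of 0 k] u0_S w(1)] Y[of k] by simp
  qed
  have phi_liminf: "\<phi> (ustar t) \<le> liminf (\<lambda>k. \<phi> (u k t))" if "0 \<le> t" for t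
  proof (rule Phi1[OF uS(2)[OF that] u_lim[OF that]])
    from bounded[of t] obtain Z where "\<forall>k r. 0 \<le> r \<and> r \<le> t \<longrightarrow> d0 (u k r) w \<le> Z" by blast
    then have Z: "d0 (u k t) w \<le> Z" for k using that by simp
    have "d0 (u k t) (u l t) \<le> Z + Z" for k l
      using S0.triangle[OF uS(2)[OF that, of k] w(1) uS(2)[OF that, of l]] Z[of k] Z[of l]
        S0.commute[of w "u l t"] by linarith
    then show "bdd_above (range (\<lambda>(k, l). d0 (u k t) (u l t)))"
      by (intro bdd_aboveI[of _ "Z + Z"]) auto
  qed

  \<comment> \<open>Lower limits of slope, velocity and total energy\<close>
  define G0 where "G0 s t = (\<integral>\<^sup>+r\<in>{s..t}. ennreal_powr (g (ustar r)) \<beta> \<partial>lborel)" for s t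
  define M0 where "M0 s t = (\<integral>\<^sup>+r\<in>{s..t}. ennreal (metric_deriv {0..} d0 ustar r powr \<theta>) \<partial>lborel)" for s t
  define E0 where "E0 s t = ennreal (1 / \<beta>) * G0 s t + ennreal (1 / \<theta>) * M0 s t" for s t
  \<comment> \<open>Convergence at every time gives the pointwise bound on [0, t]; the measurability
    that Fatou's lemma needs is that of the approximating integrands, \<open>g_meas\<close>.\<close>
  have G0_le: "G0 0 t \<le> liminf (\<lambda>k. G k 0 t)" for t
  proof -
    have "G0 0 t \<le> (\<integral>\<^sup>+r. liminf (\<lambda>k. ennreal_powr (g\<^sub>\<epsilon> (\<epsilon> k) (u k r)) \<beta> * indicator {0..t} r) \<partial>lborel)"
      unfolding G0_def
    proof (rule nn_integral_mono)
      fix r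
      show "ennreal_powr (g (ustar r)) \<beta> * indicator {0..t} r \<le>
        liminf (\<lambda>k. ennreal_powr (g\<^sub>\<epsilon> (\<epsilon> k) (u k r)) \<beta> * indicator {0..t} r)"
      proof (cases "r \<in> {0..t}")
        case True
        then have r: "0 \<le> r" by simp
        have "g (ustar r) \<le> liminf (\<lambda>k. g\<^sub>\<epsilon> (\<epsilon> k) (u k r))"
          by (rule g_liminf[OF eps_pos eps_lim uS(1)[OF r] ustar_S[OF r] u_lim[OF r]])
        then have "ennreal_powr (g (ustar r)) \<beta> \<le> liminf (\<lambda>k. ennreal_powr (g\<^sub>\<epsilon> (\<epsilon> k) (u k r)) \<beta>)"
          using beta1(1) by (intro ennreal_powr_liminf) auto
        then show ?thesis using True by simp
      qed simp
    qed
    also have "\<dots> \<le> liminf (\<lambda>k. G k 0 t)"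
      unfolding G_def
    proof (rule nn_integral_liminf)
      show "(\<lambda>r. ennreal_powr (g\<^sub>\<epsilon> (\<epsilon> k) (u k r)) \<beta> * indicator {0..t} r) \<in> borel_measurable lborel" for k
        using g_meas[of k t] by (subst (asm) borel_measurable_restrict_space_iff_ennreal) auto
    qed
    finally show ?thesis .
  qed
  have M0_le: "M0 0 t \<le> liminf (\<lambda>k. M k 0 t)" if t: "0 < t" for t
  proof -
    obtain f where f: "integrable lborel f" "\<And>x. 0 \<le> f x"
      "AE x in lborel. 0 < x \<and> x < t \<longrightarrow> ((\<lambda>s. d0 (ustar x) (ustar s) / \<bar>x - s\<bar>) \<longlongrightarrow> f x) (at x)"
      "AE x in lborel. 0 < x \<and> x < t \<longrightarrow> metric_deriv {0..} d0 ustar x = f x"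
      "AE x in lborel. 0 < x \<and> x < t \<longrightarrow> metric_deriv {0..t} d0 ustar x = f x"
      "\<And>s r. 0 \<le> s \<Longrightarrow> s \<le> r \<Longrightarrow> r \<le> t \<Longrightarrow> d0 (ustar s) (ustar r) \<le> (LINT r:{s..r}|lborel. f r)"
      by (rule AC_loc_on_metric_derivative[OF S0_metric ustar_AC th1 t]) (rule that, assumption+)
    have "M0 0 t = (\<integral>\<^sup>+r\<in>{0..t}. ennreal (f r powr \<theta>) \<partial>lborel)"
      unfolding M0_def
    proof (rule nn_integral_cong_AE)
      show "AE r in lborel. ennreal (metric_deriv {0..} d0 ustar r powr \<theta>) * indicator {0..t} r =
         ennreal (f r powr \<theta>) * indicator {0..t} r"
        using f(4) AE_lborel_singleton[of 0] AE_lborel_singleton[of t]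
        by eventually_elim (auto simp: indicator_def)
    qed
    also have "\<dots> \<le> liminf (\<lambda>k. M k 0 t)"
    proof (rule metric_deriv_liminf_le[where u=ustar and d=d0 and f=f and A=M, OF theta t f(3,2) S0.nonneg])
      show "M k 0 r = M k 0 s + M k s r" if "0 \<le> s" "s \<le> r" for k s r
        by (rule M_add[OF that])
      \<comment> \<open>The \<sigma>-convergence at both end points bounds the limit distance by a
        lower limit; the estimate \<open>d0_le\<close> holds for each k with the same factor, which
        is finite and positive and so leaves the lower limit.\<close>
      show "ennreal (d0 (ustar s) (ustar r) powr \<theta>) \<le> ennreal ((r - s) powr (\<theta> - 1)) * liminf (\<lambda>k. M k s r)"
        if sr: "0 \<le> s" "s < r" for s r
      proof -
        have r: "0 \<le> r" using sr by simp
        have "ennreal (d0 (ustar s) (ustar r) powr \<theta>) \<le> liminf (\<lambda>k. ennreal (d0 (u k s) (u k r) powr \<theta>))"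
          using theta by (intro ennreal_powr_real_liminf S0.nonneg
            sigma_lsc[OF uS(2)[OF sr(1)] uS(2)[OF r] u_lim[OF sr(1)] u_lim[OF r]]) auto
        also have "\<dots> \<le> liminf (\<lambda>k. ennreal ((r - s) powr (\<theta> - 1)) * M k s r)"
          by (intro Liminf_mono always_eventually allI d0_le sr)
        also have "\<dots> = ennreal ((r - s) powr (\<theta> - 1)) * liminf (\<lambda>k. M k s r)"
          using sr by (intro ennreal_liminf_cmult) auto
        finally show ?thesis .
      qed
    qed
    finally show ?thesis .
  qed
  have E0_le: "E0 0 t \<le> liminf (\<lambda>k. E k 0 t)" if "0 < t" for t
  proof -
    have "E0 0 t \<le> ennreal (1 / \<beta>) * liminf (\<lambda>k. G k 0 t) + ennreal (1 / \<theta>) * liminf (\<lambda>k. M k 0 t)"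
      unfolding E0_def by (intro add_mono mult_left_mono G0_le M0_le that) auto
    also have "\<dots> \<le> liminf (\<lambda>k. ennreal (1 / \<beta>) * G k 0 t) + liminf (\<lambda>k. ennreal (1 / \<theta>) * M k 0 t)"
      by (intro add_mono ennreal_mult_liminf_le)
    also have "\<dots> \<le> liminf (\<lambda>k. E k 0 t)"
      unfolding E_def by (rule ennreal_liminf_add_le)
    finally show ?thesis .
  qed
  have upper: "\<phi> (ustar t) + enn2ereal (E0 0 t) \<le> \<phi> u0" if "0 < t" for t
  proof -
    have lb: "\<phi> (ustar t) \<le> liminf (\<lambda>k. \<phi> (u k t))" "enn2ereal (E0 0 t) \<le> liminf (\<lambda>k. enn2ereal (E k 0 t))"
      using phi_liminf[of t] enn2ereal_le_liminf[OF E0_le[OF that]] that by auto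
    have "\<phi> (ustar t) \<noteq> - \<infinity>" using phi_not_MInf ustar_S that by auto
    \<comment> \<open>Excluding -\<infinity> protects the sum of lower limits in
      \<open>ereal\<close> from \<infinity> - \<infinity>.\<close>
    then have ne: "liminf (\<lambda>k. \<phi> (u k t)) \<noteq> - \<infinity>" using lb(1) by auto
    have ne2: "liminf (\<lambda>k. enn2ereal (E k 0 t)) \<noteq> - \<infinity>"
      using order_trans[OF enn2ereal_nonneg lb(2)] by auto
    have "\<phi> (ustar t) + enn2ereal (E0 0 t) \<le> liminf (\<lambda>k. \<phi> (u k t)) + liminf (\<lambda>k. enn2ereal (E k 0 t))"
      by (rule add_mono[OF lb])
    also have "\<dots> \<le> liminf (\<lambda>k. \<phi> (u k t) + enn2ereal (E k 0 t))"
      by (rule ereal_liminf_add_mono) (use ne ne2 in auto)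
    also have "\<dots> = liminf (\<lambda>k. \<phi> (u k 0))"
      using u_energy[OF order_refl that] by simp
    also have "\<dots> = \<phi> u0" by (rule lim_imp_Liminf[OF trivial_limit_sequentially phi_lim])
    finally show ?thesis .
  qed
  \<comment> \<open>Finite energy of the limit curve is itself a consequence of
    \<open>upper\<close>. It places the curve in the effective domain, where g may be tested on
    it.\<close>
  have ustar_fin: "\<bar>\<phi> (ustar t)\<bar> \<noteq> \<infinity>" if "0 \<le> t" for t
  proof (cases "t = 0")
    case True
    then show ?thesis using phi_u0 ustar_0 by simp
  next
    case False
    then have "\<phi> (ustar t) + enn2ereal (E0 0 t) \<le> \<phi> u0" using upper[of t] that by simp
    moreover have "0 \<le> enn2ereal (E0 0 t)" by simp
    ultimately show ?thesis using phi_u0 phi_not_MInf[OF ustar_S[OF that]]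
      by (cases "\<phi> (ustar t)"; cases "enn2ereal (E0 0 t)"; cases "\<phi> u0") auto
  qed
  have ustar_dom: "ustar t \<in> eff_dom S0 \<phi>" if "0 \<le> t" for t
    using ustar_fin[OF that] ustar_S[OF that] by (auto simp: eff_dom_def)
  note sug = strong_upper_gradient_energy_le[OF S0_metric g_sug ustar_AC theta beta1(1) beta ustar_dom
      E0_def[unfolded G0_def M0_def]]
  have lower: "\<bar>\<phi> (ustar t) - \<phi> (ustar s)\<bar> \<le> enn2ereal (E0 s t)" if "0 \<le> s" "s < t" for s t
    by (rule sug(1)[OF _ that])
  have E0_add: "E0 0 t = E0 0 s + E0 s t" if "0 \<le> s" "s \<le> t" for s t
    by (rule sug(2)[OF _ that])
  \<comment> \<open>With energies a, b, c at times 0, s, t and dissipations q on [0, s] and r on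
    [s, t], the bounds a - b \<le> q, b - c \<le> r and q + r \<le> a - c force equality
    throughout.\<close>
  have eq: "\<phi> (ustar s) = \<phi> (ustar t) + enn2ereal (E0 s t)" if st: "0 \<le> s" "s < t" for s t
  proof -
    obtain a b c where abc: "\<phi> u0 = ereal a" "\<phi> (ustar s) = ereal b" "\<phi> (ustar t) = ereal c"
      using phi_u0 ustar_fin[of s] ustar_fin[of t] st
      by (cases "\<phi> u0"; cases "\<phi> (ustar s)"; cases "\<phi> (ustar t)") auto
    have up: "ereal c + enn2ereal (E0 0 t) \<le> ereal a" using upper[of t] st abc by simp
    then obtain p where p: "E0 0 t = ennreal p" "0 \<le> p" by (cases "E0 0 t") auto
    have add: "E0 0 s + E0 s t = ennreal p" using E0_add[of s t] st p by simp
    then obtain q r where q: "E0 0 s = ennreal q" "0 \<le> q" and r: "E0 s t = ennreal r" "0 \<le> r"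
      by (cases "E0 0 s"; cases "E0 s t") auto
    have "p = q + r" using add q r p by (simp flip: ennreal_plus)
    moreover have "c + p \<le> a" using up p by (simp add: enn2ereal_ennreal)
    moreover have "b - c \<le> r" using lower[OF st] abc r by (simp add: enn2ereal_ennreal)
    moreover have "a - b \<le> q"
    proof (cases "s = 0")
      case True
      then show ?thesis using abc ustar_0 q by simp
    next
      case False
      then have "\<bar>\<phi> (ustar s) - \<phi> (ustar 0)\<bar> \<le> enn2ereal (E0 0 s)" using lower[of 0 s] st by simp
      then show ?thesis using abc ustar_0 q by (simp add: enn2ereal_ennreal)
    qed
    ultimately have "b = c + r" using lower[OF st] abc r by (simp add: enn2ereal_ennreal)
    then show ?thesis using abc r by (simp add: enn2ereal_ennreal)
  qed
  show ?thesis
    unfolding curve_of_maximal_slope_def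
  proof (intro conjI allI impI)
    fix s t :: real assume "0 \<le> s \<and> s < t"
    then have st: "0 \<le> s" "s < t" "0 \<le> t" by auto
    show "\<phi> (ustar t) - \<phi> (ustar s) =
          - (ereal (1 / \<beta>) * enn2ereal (\<integral>\<^sup>+r\<in>{s..t}. ennreal_powr (g (ustar r)) \<beta> \<partial>lborel))
          - ereal (1 / \<theta>) * enn2ereal (\<integral>\<^sup>+r\<in>{s..t}. ennreal (metric_deriv {0..} d0 ustar r powr \<theta>) \<partial>lborel)"
      using eq[OF st(1,2)] phi_not_MInf[OF ustar_S[OF st(3)]]
      unfolding G0_def[symmetric] M0_def[symmetric] E0_def
      by (subst energy_identity_iff[OF ustar_fin[OF st(1)] _ beta1(2,3)])
  qed (use g_sug u0 ustar_AC ustar_0 in auto)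
qed

end
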